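(* For every integer $d\ge 2$, the $d$-dimensional product copula $\Pi$ and its order transform $\Pi_T$ satisfy $$[\Pi,\Pi]=\frac{1}{2^d}<\frac{1}{d+1}=[\Pi_T,\Pi_T]$$ and hence $$\kappa[\Pi]=0<\frac{2^d-(d+1)}{(2^{d-1}-1)(d+1)}=\kappa[\Pi_T].$$ In particular, $\lim_{d\to\infty}\kappa[\Pi_T]=0$ (where for each $d$, $\Pi_T$ is the order transform of the $d$-dimensional product copula).
   Context: Notation: $\overline{\mathbb R}=[-\infty,\infty]$. The product copula is $\Pi(\mathbf u)=\prod_{k=1}^d u_k$ on $[0,1]^d$. For a copula $C$ on $[0,1]^d$, $Q^C$ is the unique Borel probability measure on $[0,1]^d$ with $Q^C[[\mathbf 0,\mathbf u]]=C(\mathbf u)$ for all $\mathbf u\in[0,1]^d$. Kendall's tau: for $d$-dimensional copulas $C,D$ put $[C,D]:=\int_{[0,1]^d}C(\mathbf u)\,dQ^D(\mathbf u)$ and $\kappa[C]:=\dfrac{2^d[C,C]-1}{2^{d-1}-1}$. Order transform: $T:\overline{\mathbb R}^d\to\overline{\mathbb R}^d$ is $(T(\mathbf x))_k:=\min_{J\subseteq\{1,\dots,d\},|J|=k}\max_{l\in J}x_l$, i.e. $T(\mathbf x)$ is the nondecreasing rearrangement of $\mathbf x$. For a copula $C$, let $H^C:\overline{\mathbb R}^d\to[0,1]$ be the distribution function extending $C$, i.e. $H^C(\mathbf x)=C(h(x_1),\dots,h(x_d))$ with $h(x)=\max\{0,\min\{x,1\}\}$, and let $Q^{H^C}$ be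 the corresponding probability measure. Let $H^C_T$ be the distribution function of the image measure $(Q^{H^C})_T=Q^{H^C}\circ T^{-1}$. Its univariate marginal distribution functions $(H^C_T)_1,\dots,(H^C_T)_d$ are continuous, so there is a unique copula $C_T$, called the order transform of $C$, with $H^C_T(\mathbf x)=C_T\big((H^C_T)_1(x_1),\dots,(H^C_T)_d(x_d)\big)$ for all $\mathbf x\in\overline{\mathbb R}^d$. *)

theory Defs
  imports "HOL-Probability.Probability"
begin

text \<open>
  Since the dimension \<open>d\<close> varies (a limit \<open>d \<rightarrow> \<infinity>\<close> is taken), vectors are extensional functions
  on the index set \<open>{1..d}\<close>, and functions on the unit cube are extensional on the cube, so that
  equality of copulas is equality as functions on the cube.
\<close>

definition unit_cube :: "nat \<Rightarrow> (nat \<Rightarrow> real) set" where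
  "unit_cube d = ({1..d} \<rightarrow>\<^sub>E {0..1})"

text \<open>The alternating sum below is the volume assigned by \<open>C\<close> to the box \<open>[a, b]\<close>.\<close>

definition is_copula :: "nat \<Rightarrow> ((nat \<Rightarrow> real) \<Rightarrow> real) \<Rightarrow> bool" where
  "is_copula d C \<longleftrightarrow>
     C \<in> unit_cube d \<rightarrow>\<^sub>E {0..1} \<and>
     (\<forall>u\<in>unit_cube d. (\<exists>k\<in>{1..d}. u k = 0) \<longrightarrow> C u = 0) \<and>
     (\<forall>k\<in>{1..d}. \<forall>t\<in>{0..1}. C (\<lambda>j\<in>{1..d}. if j = k then t else 1) = t) \<and>
     (\<forall>a\<in>unit_cube d. \<forall>b\<in>unit_cube d. (\<forall>k\<in>{1..d}. a k \<le> b k) \<longrightarrow>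
        0 \<le> (\<Sum>J\<in>Pow {1..d}. (- 1) ^ card J * C (\<lambda>k\<in>{1..d}. if k \<in> J then a k else b k)))"

definition product_copula :: "nat \<Rightarrow> (nat \<Rightarrow> real) \<Rightarrow> real" where
  "product_copula d = (\<lambda>u\<in>unit_cube d. \<Prod>k=1..d. u k)"

definition copula_measure :: "nat \<Rightarrow> ((nat \<Rightarrow> real) \<Rightarrow> real) \<Rightarrow> (nat \<Rightarrow> real) measure" where
  "copula_measure d C = (THE Q. prob_space Q \<and>
     sets Q = sets (Pi\<^sub>M {1..d} (\<lambda>_. restrict_space borel {0..1})) \<and>
     (\<forall>u\<in>unit_cube d. measure Q (\<Pi>\<^sub>E k\<in>{1..d}. {0..u k}) = C u))"

definition copula_bracket ::
  "nat \<Rightarrow> ((nat \<Rightarrow> real) \<Rightarrow> real) \<Rightarrow> ((nat \<Rightarrow> real) \<Rightarrow> real) \<Rightarrow> real" where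
  "copula_bracket d C D = (\<integral>u. C u \<partial>copula_measure d D)"

definition kendall_tau :: "nat \<Rightarrow> ((nat \<Rightarrow> real) \<Rightarrow> real) \<Rightarrow> real" where
  "kendall_tau d C = (2 ^ d * copula_bracket d C C - 1) / (2 ^ (d - 1) - 1)"

definition order_map :: "nat \<Rightarrow> (nat \<Rightarrow> ereal) \<Rightarrow> nat \<Rightarrow> ereal" where
  "order_map d x = (\<lambda>k\<in>{1..d}. Min {Max (x ` J) | J. J \<subseteq> {1..d} \<and> card J = k})"

abbreviation ereal_space :: "nat \<Rightarrow> (nat \<Rightarrow> ereal) measure" where
  "ereal_space d \<equiv> Pi\<^sub>M {1..d} (\<lambda>_. borel)"

definition copula_df :: "nat \<Rightarrow> ((nat \<Rightarrow> real) \<Rightarrow> real) \<Rightarrow> (nat \<Rightarrow> ereal) \<Rightarrow> real" where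
  "copula_df d C x = C (\<lambda>k\<in>{1..d}. real_of_ereal (max 0 (min (x k) 1)))"

definition df_measure :: "nat \<Rightarrow> ((nat \<Rightarrow> ereal) \<Rightarrow> real) \<Rightarrow> (nat \<Rightarrow> ereal) measure" where
  "df_measure d H = (THE Q. prob_space Q \<and> sets Q = sets (ereal_space d) \<and>
     (\<forall>x\<in>space (ereal_space d). measure Q (\<Pi>\<^sub>E k\<in>{1..d}. {..x k}) = H x))"

definition order_df :: "nat \<Rightarrow> ((nat \<Rightarrow> real) \<Rightarrow> real) \<Rightarrow> (nat \<Rightarrow> ereal) \<Rightarrow> real" where
  "order_df d C x =
     measure (distr (df_measure d (copula_df d C)) (ereal_space d) (order_map d))
       (\<Pi>\<^sub>E k\<in>{1..d}. {..x k})"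

definition marginal_df :: "nat \<Rightarrow> ((nat \<Rightarrow> ereal) \<Rightarrow> real) \<Rightarrow> nat \<Rightarrow> ereal \<Rightarrow> real" where
  "marginal_df d H k t = H (\<lambda>j\<in>{1..d}. if j = k then t else \<infinity>)"

definition order_transform :: "nat \<Rightarrow> ((nat \<Rightarrow> real) \<Rightarrow> real) \<Rightarrow> (nat \<Rightarrow> real) \<Rightarrow> real" where
  "order_transform d C = (THE D. is_copula d D \<and>
     (\<forall>x\<in>space (ereal_space d).
        order_df d C x = D (\<lambda>k\<in>{1..d}. marginal_df d (order_df d C) k (x k))))"

end

theory Submission
  imports Defs "HOL-Real_Asymp.Real_Asymp"
begin

text \<open>
  Let \<open>U\<close> be a vector of \<open>d\<close> independent uniform variables and let \<open>F\<^sub>k\<close> be the distribution function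
  of its \<open>k\<close>-th order statistic \<open>U[k]\<close>. Each \<open>F\<^sub>k\<close> maps \<open>[0, 1]\<close> continuously and strictly
  increasingly onto itself, so the order transform of the product copula is the distribution
  function of \<open>(F\<^sub>1(U[1]), \<dots>, F\<^sub>d(U[d]))\<close>. Its bracket with itself is therefore the probability that an
  independent copy \<open>U'\<close> satisfies \<open>U'[k] \<le> U[k]\<close> for all \<open>k\<close>, that is, that every initial segment
  of the line contains at least as many points of \<open>U'\<close> as of \<open>U\<close>. For \<open>a\<close> points of the first and
  \<open>b\<close> points of the second kind, conditioning on the largest of all points gives the recursion of
  the ballot problem, with solution \<open>(a - b + 1) / (a + 1)\<close>; put \<open>a = b = d\<close>.
\<close>

section \<open>The ballot problem for uniform points\<close>

text \<open>The distribution lives on all of \<open>real\<close>, so that its measurable sets are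
  exactly those of \<open>borel\<close>; the complement of the unit interval is a null set.\<close>

definition unif :: "real measure" where
  "unif = uniform_measure lborel {0..1}"

lemma sets_unif [simp, measurable_cong]: "sets unif = sets borel"
  by (simp add: unif_def)

lemma space_unif [simp]: "space unif = UNIV"
  by (simp add: unif_def)

lemma prob_space_unif: "prob_space unif"
  unfolding unif_def by (rule prob_space_uniform_measure) auto

interpretation unif: prob_space unif
  by (rule prob_space_unif)

interpretation unif_prod: product_prob_space "\<lambda>_::nat. unif" I for I
  by unfold_locales

lemma prob_space_PiM_unif: "prob_space (PiM I (\<lambda>_. unif))"
  by (intro prob_space_PiM prob_space_unif)

lemma measurable_component_unif [measurable (raw)]:
  "i \<in> I \<Longrightarrow> (\<lambda>x. x i) \<in> borel_measurable (PiM I (\<lambda>_. unif))"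
  using measurable_component_singleton[of i I "\<lambda>_. unif"]
  unfolding measurable_cong_sets[OF refl sets_unif] .

text \<open>Drops the restriction to \<open>space M\<close> from the integrand, so that the rules
  for iterated integration over \<open>PiM\<close> apply to a plain predicate.\<close>

lemma emeasure_Collect_eq_nn_integral:
  assumes "{x\<in>space M. P x} \<in> sets M"
  shows "emeasure M {x\<in>space M. P x} = (\<integral>\<^sup>+x. indicator {x. P x} x \<partial>M)"
proof -
  have "emeasure M {x\<in>space M. P x} = (\<integral>\<^sup>+x. indicator {x\<in>space M. P x} x \<partial>M)"
    using assms by simp
  also have "\<dots> = (\<integral>\<^sup>+x. indicator {x. P x} x \<partial>M)"
    by (intro nn_integral_cong) (simp split: split_indicator)
  finally show ?thesis .
qed

lemma nn_integral_unif:
  "f \<in> borel_measurable borel \<Longrightarrow> (\<integral>\<^sup>+x. f x \<partial>unif) = (\<integral>\<^sup>+x. f x * indicator {0..1} x \<partial>lborel)"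
  unfolding unif_def by (subst nn_integral_uniform_measure) (auto simp: divide_ennreal_def)

lemma emeasure_unif: "A \<in> sets borel \<Longrightarrow> emeasure unif A = emeasure lborel ({0..1} \<inter> A)"
  unfolding unif_def by (subst emeasure_uniform_measure) (auto simp: divide_ennreal_def)

lemma emeasure_unif_singleton: "emeasure unif {c} = 0"
proof -
  have "emeasure lborel ({0..1} \<inter> {c}) \<le> emeasure lborel {c}"
    by (rule emeasure_mono) auto
  then show ?thesis
    by (simp add: emeasure_unif)
qed

lemma AE_unif_neq: "AE x in unif. x \<noteq> c"
  by (rule AE_I[of _ _ "{c}"]) (auto simp: emeasure_unif_singleton)

lemma AE_unif_Ioo: "AE x in unif. x \<in> {0<..<1}"
proof -
  have "AE x in unif. x \<in> {0..1}"
    unfolding unif_def by (rule AE_uniform_measureI) auto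
  with AE_unif_neq[of 0] AE_unif_neq[of 1] show ?thesis
    by eventually_elim auto
qed

text \<open>Integrate over coordinate \<open>i\<close> first: with the others fixed, a tie forces
  \<open>x i\<close> to be the single value \<open>x j\<close>, which is null for
  \<open>unif\<close>.\<close>

lemma AE_PiM_unif_neq:
  assumes "finite I" "i \<in> I" "j \<in> I" "i \<noteq> j"
  shows "AE x in PiM I (\<lambda>_::nat. unif). x i \<noteq> x j"
proof -
  define K where "K = I - {i}"
  have K: "finite K" "i \<notin> K" "I = insert i K" "j \<in> K"
    using assms by (auto simp: K_def)
  have [measurable]: "(\<lambda>x. x j) \<in> borel_measurable (PiM (insert i K) (\<lambda>_. unif))"
      "(\<lambda>x. x i) \<in> borel_measurable (PiM (insert i K) (\<lambda>_. unif))"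
    using K(4) by (auto intro: measurable_component_unif)
  have "emeasure (PiM I (\<lambda>_. unif)) {x \<in> space (PiM I (\<lambda>_. unif)). x i = x j}
     = (\<integral>\<^sup>+x. indicator {x. x i = x j} x \<partial>PiM I (\<lambda>_. unif))"
    unfolding K(3) by (intro emeasure_Collect_eq_nn_integral) auto
  also have "\<dots> = (\<integral>\<^sup>+x. indicator {0} (x i - x j) \<partial>PiM (insert i K) (\<lambda>_. unif))"
    unfolding K(3) by (intro nn_integral_cong) (auto split: split_indicator)
  also have "\<dots> = (\<integral>\<^sup>+x. (\<integral>\<^sup>+y. indicator {0} ((x(i := y)) i - (x(i := y)) j) \<partial>unif) \<partial>PiM K (\<lambda>_. unif))"
    using K(1,2) by (intro unif_prod.product_nn_integral_insert) measurable
  also have "\<dots> = (\<integral>\<^sup>+x. (\<integral>\<^sup>+y. indicator {x j} y \<partial>unif) \<partial>PiM K (\<lambda>_. unif))"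
    using assms(4) by (intro nn_integral_cong) (auto split: split_indicator)
  also have "\<dots> = 0"
    by (simp add: emeasure_unif_singleton)
  finally have "emeasure (PiM I (\<lambda>_. unif)) {x \<in> space (PiM I (\<lambda>_. unif)). x i = x j} = 0" .
  then show ?thesis
    unfolding K(3) using K(4) by (subst AE_iff_measurable[OF _ refl]) auto
qed

text \<open>
  Comparing the counts only at the points \<open>x j\<close> with \<open>j \<in> B\<close> is enough, and makes
  measurability immediate.
\<close>

definition ballot :: "nat set \<Rightarrow> nat set \<Rightarrow> (nat \<Rightarrow> real) \<Rightarrow> bool" where
  "ballot A B x \<longleftrightarrow> (\<forall>j\<in>B. card {i\<in>B. x i \<le> x j} \<le> card {i\<in>A. x i \<le> x j})"

text \<open>The cardinality is a finite sum of indicators of measurable events.\<close>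

lemma measurable_card_le [measurable]:
  fixes g :: "'a \<Rightarrow> 'b::{linorder_topology, second_countable_topology}"
  assumes "finite A" and [measurable]: "\<And>i. i \<in> A \<Longrightarrow> f i \<in> borel_measurable M" "g \<in> borel_measurable M"
  shows "(\<lambda>x. card {i\<in>A. f i x \<le> g x}) \<in> measurable M (count_space UNIV)"
proof -
  have eq: "card {i\<in>A. f i x \<le> g x} = (\<Sum>i\<in>A. if f i x \<le> g x then 1 else 0)" for x
    using assms(1) by (simp add: sum.If_cases Int_def)
  show ?thesis
    unfolding eq by measurable
qed

lemma measurable_ballot [measurable]:
  assumes "finite A" "finite B" "A \<union> B \<subseteq> I"
  shows "Measurable.pred (PiM I (\<lambda>_. unif)) (ballot A B)"
proof -
  have [measurable]: "(\<lambda>x. x i) \<in> borel_measurable (PiM I (\<lambda>_. unif))" if "i \<in> A \<union> B" for i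
    using that assms by (intro measurable_component_unif) auto
  show ?thesis
    unfolding ballot_def using assms by measurable
qed

text \<open>At every other point of \<open>B\<close> the strict maximum \<open>x i\<close> is not
  counted. If \<open>i\<close> itself lies in \<open>B\<close>, its condition counts everything and
  reads \<open>card B \<le> card A\<close>, which is assumed.\<close>

lemma ballot_remove_max:
  assumes "finite A" "finite B" "A \<inter> B = {}" "card B \<le> card A" "i \<in> A \<union> B"
    and max: "\<forall>j\<in>A \<union> B - {i}. x j < x i"
  shows "ballot A B x \<longleftrightarrow> ballot (A - {i}) (B - {i}) x"
proof -
  have le: "x j \<le> x i" if "j \<in> A \<union> B" for j
    using max that by (cases "j = i") (auto intro: less_imp_le)
  have all: "{k\<in>A. x k \<le> x i} = A" "{k\<in>B. x k \<le> x i} = B"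
    using le by auto
  have A: "{k\<in>A. x k \<le> x j} = {k\<in>A - {i}. x k \<le> x j}" 
   and B: "{k\<in>B. x k \<le> x j} = {k\<in>B - {i}. x k \<le> x j}" if "j \<in> B - {i}" for j
    using max[rule_format, of j] that by auto
  have "ballot A B x \<longleftrightarrow> (\<forall>j\<in>B - {i}. card {k\<in>B. x k \<le> x j} \<le> card {k\<in>A. x k \<le> x j})"
    unfolding ballot_def using all assms(4) by force
  also have "\<dots> \<longleftrightarrow> ballot (A - {i}) (B - {i}) x"
    unfolding ballot_def by (intro ball_cong refl) (simp add: A B)
  finally show ?thesis .
qed

lemma finite_has_max_value:
  fixes f :: "'a \<Rightarrow> real"
  assumes "finite S" "S \<noteq> {}"
  shows "\<exists>m\<in>S. \<forall>i\<in>S. f i \<le> f m"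
proof -
  have "Max (f ` S) \<in> f ` S"
    using assms by (intro Max_in) auto
  then obtain m where "m \<in> S" "f m = Max (f ` S)" by auto
  then show ?thesis
    using assms by (metis Max_ge finite_imageI imageI)
qed

text \<open>At the largest point of \<open>B\<close> all of \<open>B\<close> is counted, and
  \<open>A\<close> has too few points to match it.\<close>

lemma not_ballot:
  assumes "finite A" "finite B" "card A < card B"
  shows "\<not> ballot A B x"
proof
  assume b: "ballot A B x"
  have "B \<noteq> {}" using assms by auto
  then obtain j where j: "j \<in> B" "\<And>i. i \<in> B \<Longrightarrow> x i \<le> x j"
    using finite_has_max_value[of B x] assms(2) by blast
  then have "{i\<in>B. x i \<le> x j} = B" by auto
  with b j have "card B \<le> card {i\<in>A. x i \<le> x j}"
    unfolding ballot_def by force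
  also have "\<dots> \<le> card A"
    using assms by (intro card_mono) auto
  finally show False using assms by simp
qed

lemma ballot_upd: "i \<notin> A \<union> B \<Longrightarrow> ballot A B (x(i := y)) = ballot A B x"
  unfolding ballot_def by (intro ball_cong refl arg_cong2[where f="(\<le>)"] arg_cong[where f=card]) auto

text \<open>Almost surely there are no ties, so a largest coordinate is strictly largest.\<close>

lemma AE_strict_max:
  assumes "finite I" "I \<noteq> {}"
  shows "AE x in PiM I (\<lambda>_::nat. unif). \<exists>i\<in>I. \<forall>j\<in>I - {i}. x j < x i"
proof -
  have "AE x in PiM I (\<lambda>_. unif). \<forall>i\<in>I. \<forall>j\<in>I - {i}. x i \<noteq> x j"
    using assms by (intro AE_finite_allI) (auto intro: AE_PiM_unif_neq)
  then show ?thesis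
  proof eventually_elim
    case (elim x)
    obtain i where i: "i \<in> I" "\<And>j. j \<in> I \<Longrightarrow> x j \<le> x i"
      using finite_has_max_value[of I x] assms by blast
    have "x j < x i" if "j \<in> I - {i}" for j
      using i(2)[of j] elim i(1) that by (metis DiffD1 order_le_less)
    with i(1) show ?case by blast
  qed
qed

text \<open>This is the integration over the value \<open>w\<close> of the largest point in the
  ballot recursion; \<open>c\<close> takes the constant ballot factor.\<close>

lemma nn_integral_power_unif:
  assumes "0 \<le> t" "t \<le> 1" "0 \<le> c"
  shows "(\<integral>\<^sup>+w. ennreal (w ^ n * c) * indicator {..<t} w \<partial>unif) = ennreal (t ^ Suc n / real (Suc n) * c)"
proof -
  \<comment> \<open>Inside the unit interval, \<open>{..<t}\<close> and \<open>{0..t}\<close> differ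
    only by the endpoint \<open>t\<close>, a null set.\<close>
  have "(\<integral>\<^sup>+w. ennreal (w ^ n * c) * indicator {..<t} w \<partial>unif)
     = (\<integral>\<^sup>+w. ennreal (w ^ n * c) * indicator {0..t} w \<partial>lborel)"
    using assms AE_lborel_singleton[of t]
    by (subst nn_integral_unif) (auto intro!: nn_integral_cong_AE split: split_indicator)
  also have "\<dots> = ennreal (t ^ Suc n / real (Suc n) * c - 0 ^ Suc n / real (Suc n) * c)"
    using assms
    by (intro nn_integral_FTC_Icc) (auto intro!: derivative_eq_intros simp del: power_Suc)
  finally show ?thesis by simp
qed

text \<open>The ballot recursion after integration: the largest point is one of \<open>a\<close>
  points of the first kind or of \<open>b\<close> of the second. The forms
  \<open>Suc (a + b - 1)\<close> and \<open>real a - 1\<close> match what the integral and the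
  reduced cardinalities produce.\<close>

lemma ballot_arith:
  fixes a b :: nat and t :: real
  assumes "b \<le> a" "0 < a + b"
  shows "real a * (t ^ Suc (a + b - 1) / real (Suc (a + b - 1)) * ((real a - 1 - real b + 1) / (real a - 1 + 1)))
     + real b * (t ^ Suc (a + b - 1) / real (Suc (a + b - 1)) * ((real a - (real b - 1) + 1) / (real a + 1)))
     = t ^ (a + b) * ((real a - real b + 1) / (real a + 1))"
proof -
  have "Suc (a + b - 1) = a + b" "0 < a" using assms by auto
  have *: "real a * ((real a - 1 - real b + 1) / (real a - 1 + 1)) + real b * ((real a - (real b - 1) + 1) / (real a + 1))
    = real (a + b) * ((real a - real b + 1) / (real a + 1))"
    using \<open>0 < a\<close> by (simp add: divide_simps) (simp add: algebra_simps)
  show ?thesis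
    unfolding \<open>Suc (a + b - 1) = a + b\<close>
    using arg_cong[OF *, of "\<lambda>z. t ^ (a+b) / real (a+b) * z"] assms(2)
    unfolding distrib_left mult.left_commute[of "t ^ (a+b) / real (a+b)"] by simp
qed

text \<open>
  The bound \<open>t\<close> on the points carries the induction: the value of the largest point is the
  bound for the remaining ones. Strict inequalities make this exact, with no null sets. The case
  \<open>card B = card A + 1\<close>, where the probability vanishes, is reached when \<open>card A = card B\<close> and the
  largest point lies in \<open>A\<close>.
\<close>

lemma emeasure_ballot:
  assumes "finite A" "finite B" "A \<inter> B = {}" "card B \<le> Suc (card A)" "0 \<le> t" "t \<le> 1"
  shows "emeasure (PiM (A \<union> B) (\<lambda>_. unif))
      {x\<in>space (PiM (A \<union> B) (\<lambda>_. unif)). (\<forall>i\<in>A \<union> B. x i < t) \<and> ballot A B x}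
    = ennreal (t ^ (card A + card B) * ((real (card A) - real (card B) + 1) / (real (card A) + 1)))"
  using assms
proof (induction "card A + card B" arbitrary: A B t rule: less_induct)
  case less
  note [simp] = less.prems(1,2)
  let ?I = "A \<union> B" and ?P = "PiM (A \<union> B) (\<lambda>_. unif)"
  let ?S = "\<lambda>x. (\<forall>i\<in>A \<union> B. x i < t) \<and> ballot A B x"
  let ?M = "\<lambda>i x. \<forall>j\<in>?I - {i}. x j < x i"
  let ?c = "\<lambda>a b. (a - b + 1) / (a + 1) :: real"
  have [measurable]: "Measurable.pred ?P (ballot A B)"
    by (rule measurable_ballot) auto
  \<comment> \<open>If \<open>card B \<le> card A\<close>, an empty \<open>A\<close> forces an empty
    \<open>B\<close>. The last case thus has a point in \<open>A\<close>, which keeps the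
    denominators of the recursion nonzero.\<close>
  consider "card B = Suc (card A)" | "A = {}" "B = {}" | "card B \<le> card A" "A \<noteq> {}"
    using less.prems(2,4) by (metis card.empty card_0_eq le_Suc_eq le_zero_eq)
  then show ?case
  proof cases
    case 1
    then show ?thesis
      using not_ballot[of A B] by simp
  next
    case 2
    then show ?thesis
      by (simp add: ballot_def space_PiM PiM_empty)
  next
    case 3
    \<comment> \<open>Writing both removals treats \<open>i \<in> A\<close> and
      \<open>i \<in> B\<close> together, since one of them changes nothing.\<close>
    have step: "emeasure ?P {x\<in>space ?P. ?M i x \<and> ?S x} =
        (\<integral>\<^sup>+w. emeasure (PiM ((A - {i}) \<union> (B - {i})) (\<lambda>_. unif))
          {x\<in>space (PiM ((A - {i}) \<union> (B - {i})) (\<lambda>_. unif)).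
            (\<forall>j\<in>(A - {i}) \<union> (B - {i}). x j < w) \<and> ballot (A - {i}) (B - {i}) x} * indicator {..<t} w \<partial>unif)"
      if i: "i \<in> ?I" for i
    proof -
      define K where "K = (A - {i}) \<union> (B - {i})"
      have K: "?I = insert i K" "i \<notin> K" "finite K" "?I - {i} = K"
        using i by (auto simp: K_def)
      have [measurable]: "Measurable.pred (PiM K (\<lambda>_. unif)) (ballot (A - {i}) (B - {i}))"
        by (rule measurable_ballot) (auto simp: K_def)
      have [measurable]: "Measurable.pred (PiM (insert i K) (\<lambda>_. unif)) (ballot (A - {i}) (B - {i}))"
        by (rule measurable_ballot) (auto simp: K_def)
      \<comment> \<open>Under a strict maximum at \<open>i\<close>, the bound \<open>t\<close> on
        all points reduces to \<open>x i < t\<close>; coordinate \<open>i\<close> is then integrated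
        outermost.\<close>
      have "{x\<in>space ?P. ?M i x \<and> ?S x} = {x\<in>space ?P. x i < t \<and> (\<forall>j\<in>K. x j < x i) \<and> ballot (A - {i}) (B - {i}) x}"
        using ballot_remove_max[OF _ _ less.prems(3) 3(1) i] i K(1,4) by (auto 4 3)
      also have "emeasure ?P \<dots> = (\<integral>\<^sup>+x. indicator {x. x i < t \<and> (\<forall>j\<in>K. x j < x i) \<and> ballot (A - {i}) (B - {i}) x} x \<partial>?P)"
        unfolding K(1) using K(3) by (intro emeasure_Collect_eq_nn_integral) measurable
      also have "\<dots> = (\<integral>\<^sup>+w. (\<integral>\<^sup>+x. indicator {x\<in>space (PiM K (\<lambda>_. unif)). (\<forall>j\<in>K. x j < w) \<and> ballot (A - {i}) (B - {i}) x} x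
            * indicator {..<t} w \<partial>PiM K (\<lambda>_. unif)) \<partial>unif)"
        unfolding K(1) using K(2,3)
        by (subst unif_prod.product_nn_integral_insert_rev)
          (auto intro!: nn_integral_cong split: split_indicator simp: ballot_upd)
      also have "\<dots> = (\<integral>\<^sup>+w. emeasure (PiM K (\<lambda>_. unif))
          {x\<in>space (PiM K (\<lambda>_. unif)). (\<forall>j\<in>K. x j < w) \<and> ballot (A - {i}) (B - {i}) x} * indicator {..<t} w \<partial>unif)"
        using K(3) by (intro nn_integral_cong) (subst nn_integral_multc, auto)
      finally show ?thesis unfolding K_def .
    qed
    have stepA: "emeasure ?P {x\<in>space ?P. ?M i x \<and> ?S x} =
       ennreal (t ^ Suc (card A + card B - 1) / real (Suc (card A + card B - 1)) * ?c (real (card A) - 1) (real (card B)))"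
      if i: "i \<in> A" for i
    proof -
      have [simp]: "B - {i} = B" "i \<notin> B" using i less.prems(3) by auto
      have c: "card A > 0" using i by (auto simp: card_gt_0_iff)
      have "emeasure ?P {x\<in>space ?P. ?M i x \<and> ?S x} =
        (\<integral>\<^sup>+w. ennreal (w ^ (card A + card B - 1) * ?c (real (card A) - 1) (real (card B))) * indicator {..<t} w \<partial>unif)"
        unfolding step[OF UnI1[OF i]]
      \<comment> \<open>The induction hypothesis requires \<open>w\<close> in the unit interval,
        which holds almost surely.\<close>
      proof (rule nn_integral_cong_AE, use AE_unif_Ioo in eventually_elim)
        case (elim w)
        then show ?case
          using less.hyps[of "A - {i}" B w] i less.prems c 3
          by (auto simp: of_nat_diff split: split_indicator)
      qed
      also have "\<dots> = ennreal (t ^ Suc (card A + card B - 1) / real (Suc (card A + card B - 1)) * ?c (real (card A) - 1) (real (card B)))"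
        using less.prems 3 by (intro nn_integral_power_unif) auto
      finally show ?thesis .
    qed
    have stepB: "emeasure ?P {x\<in>space ?P. ?M i x \<and> ?S x} =
       ennreal (t ^ Suc (card A + card B - 1) / real (Suc (card A + card B - 1)) * ?c (real (card A)) (real (card B) - 1))"
      if i: "i \<in> B" for i
    proof -
      have [simp]: "A - {i} = A" "i \<notin> A" "A \<inter> (B - {i}) = {}" using i less.prems(3) by auto
      have c: "card B > 0" using i by (auto simp: card_gt_0_iff)
      have "emeasure ?P {x\<in>space ?P. ?M i x \<and> ?S x} =
        (\<integral>\<^sup>+w. ennreal (w ^ (card A + card B - 1) * ?c (real (card A)) (real (card B) - 1)) * indicator {..<t} w \<partial>unif)"
        unfolding step[OF UnI2[OF i]]
      proof (rule nn_integral_cong_AE, use AE_unif_Ioo in eventually_elim)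
        case (elim w)
        then show ?case
          using less.hyps[of A "B - {i}" w] i less.prems c 3
          by (auto simp: of_nat_diff split: split_indicator)
      qed
      also have "\<dots> = ennreal (t ^ Suc (card A + card B - 1) / real (Suc (card A + card B - 1)) * ?c (real (card A)) (real (card B) - 1))"
        using less.prems 3 by (intro nn_integral_power_unif) auto
      finally show ?thesis .
    qed
    \<comment> \<open>Almost every point has a strict maximum at some \<open>i\<close> and no point
      has two, so up to a null set the event splits disjointly.\<close>
    have "emeasure ?P {x\<in>space ?P. ?S x} = emeasure ?P (\<Union>i\<in>?I. {x\<in>space ?P. ?M i x \<and> ?S x})"
    proof (rule emeasure_eq_AE)
      show "AE x in ?P. x \<in> {x\<in>space ?P. ?S x} \<longleftrightarrow> x \<in> (\<Union>i\<in>?I. {x\<in>space ?P. ?M i x \<and> ?S x})"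
        by (rule eventually_mono[OF AE_strict_max[of ?I]]) (use 3 in auto)
    qed auto
    also have "\<dots> = (\<Sum>i\<in>?I. emeasure ?P {x\<in>space ?P. ?M i x \<and> ?S x})"
    proof (rule sum_emeasure[symmetric])
      show "disjoint_family_on (\<lambda>i. {x\<in>space ?P. ?M i x \<and> ?S x}) ?I"
        unfolding disjoint_family_on_def by (auto 4 3 dest: less_asym)
    qed auto
    also have "\<dots> = (\<Sum>i\<in>A. emeasure ?P {x\<in>space ?P. ?M i x \<and> ?S x}) + (\<Sum>i\<in>B. emeasure ?P {x\<in>space ?P. ?M i x \<and> ?S x})"
      using less.prems by (intro sum.union_disjoint) auto
    also have "\<dots> = ennreal (real (card A) * (t ^ Suc (card A + card B - 1) / real (Suc (card A + card B - 1)) * ?c (real (card A) - 1) (real (card B)))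
       + real (card B) * (t ^ Suc (card A + card B - 1) / real (Suc (card A + card B - 1)) * ?c (real (card A)) (real (card B) - 1)))"
      using less.prems 3
      by (simp add: stepA stepB ennreal_of_nat_eq_real_of_nat ennreal_mult[symmetric] ennreal_plus[symmetric]
           del: ennreal_plus power_Suc of_nat_Suc)
    also have "\<dots> = ennreal (t ^ (card A + card B) * ?c (real (card A)) (real (card B)))"
      using 3 by (subst ballot_arith) (auto simp: card_gt_0_iff)
    finally show ?thesis .
  qed
qed

section \<open>Measures determined by their distribution functions\<close>

text \<open>Boxes with sides in \<open>E\<close> form an intersection-stable generator of the
  product sigma-algebra. This gives the uniqueness behind the definite descriptions
  \<open>copula_measure\<close> and \<open>df_measure\<close>.\<close>

lemma prob_measure_eqI_PiE:
  assumes "finite I" and Q: "prob_space Q1" "prob_space Q2"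
    and sets: "sets Q1 = sets (PiM I (\<lambda>_. N))" "sets Q2 = sets (PiM I (\<lambda>_. N))"
    and E: "sets N = sigma_sets \<Omega> E" "E \<subseteq> Pow \<Omega>" "\<Omega> \<in> E" "Int_stable E"
    and eq: "\<And>A. A \<in> I \<rightarrow> E \<Longrightarrow> measure Q1 (Pi\<^sub>E I A) = measure Q2 (Pi\<^sub>E I A)"
  shows "Q1 = Q2"
proof -
  interpret Q1: prob_space Q1 by fact
  interpret Q2: prob_space Q2 by fact
  define G where "G = {Pi\<^sub>E I A | A. A \<in> I \<rightarrow> E}"
  have sub: "Pi\<^sub>E I A \<subseteq> (\<Pi>\<^sub>E i\<in>I. \<Omega>)" if "A \<in> I \<rightarrow> E" for A
    using that E(2) by (intro PiE_mono) auto
  have GP: "G \<subseteq> Pow (\<Pi>\<^sub>E i\<in>I. \<Omega>)"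
    using sub by (auto simp only: G_def Pow_iff)
  \<comment> \<open>\<open>sets_PiM_sigma\<close> generates by cylinders over blocks of indices;
    with the single block \<open>I\<close> these are the boxes.\<close>
  have G: "{{f\<in>(\<Pi>\<^sub>E i\<in>I. \<Omega>). \<forall>i\<in>j. f i \<in> A i} | A j. j \<in> {I} \<and> A \<in> Pi j (\<lambda>_. E)} = G"
  proof -
    have eqA: "{f\<in>(\<Pi>\<^sub>E i\<in>I. \<Omega>). \<forall>i\<in>I. f i \<in> A i} = Pi\<^sub>E I A" if "A \<in> I \<rightarrow> E" for A
      using sub[OF that] by (auto simp: PiE_iff extensional_def)
    show ?thesis
    proof (intro equalityI subsetI)
      fix X assume "X \<in> {{f\<in>(\<Pi>\<^sub>E i\<in>I. \<Omega>). \<forall>i\<in>j. f i \<in> A i} | A j. j \<in> {I} \<and> A \<in> Pi j (\<lambda>_. E)}"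
      then obtain A where "A \<in> I \<rightarrow> E" "X = {f\<in>(\<Pi>\<^sub>E i\<in>I. \<Omega>). \<forall>i\<in>I. f i \<in> A i}" by blast
      then show "X \<in> G" unfolding G_def using eqA by blast
    next
      fix X assume "X \<in> G"
      then obtain A where "A \<in> I \<rightarrow> E" "X = Pi\<^sub>E I A" unfolding G_def by blast
      then show "X \<in> {{f\<in>(\<Pi>\<^sub>E i\<in>I. \<Omega>). \<forall>i\<in>j. f i \<in> A i} | A j. j \<in> {I} \<and> A \<in> Pi j (\<lambda>_. E)}"
        using eqA[symmetric] by blast
    qed
  qed
  have "sets (PiM I (\<lambda>_. N)) = sets (PiM I (\<lambda>_. sigma \<Omega> E))"
    using E by (intro sets_PiM_cong) auto
  also have "\<dots> = sets (sigma (\<Pi>\<^sub>E i\<in>I. \<Omega>) G)"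
    unfolding G[symmetric] using \<open>finite I\<close> E
    by (intro sets_PiM_sigma) (auto intro!: exI[of _ "{\<Omega>}"])
  also have "\<dots> = sigma_sets (\<Pi>\<^sub>E i\<in>I. \<Omega>) G"
    using GP by (rule sets_measure_of)
  finally have S: "sets (PiM I (\<lambda>_. N)) = sigma_sets (\<Pi>\<^sub>E i\<in>I. \<Omega>) G" .
  show ?thesis
  proof (rule measure_eqI_generator_eq[where E=G and \<Omega>="\<Pi>\<^sub>E i\<in>I. \<Omega>" and A="\<lambda>_. \<Pi>\<^sub>E i\<in>I. \<Omega>"])
    show "Int_stable G"
    proof (rule Int_stableI)
      fix a b assume "a \<in> G" "b \<in> G"
      then obtain A B where "A \<in> I \<rightarrow> E" "B \<in> I \<rightarrow> E" "a = Pi\<^sub>E I A" "b = Pi\<^sub>E I B"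
        by (auto simp: G_def)
      then show "a \<inter> b \<in> G"
        using E(4) by (auto simp: G_def PiE_Int Int_stable_def Pi_iff intro!: exI[of _ "\<lambda>i. A i \<inter> B i"])
    qed
    show "G \<subseteq> Pow (\<Pi>\<^sub>E i\<in>I. \<Omega>)"
      by (rule GP)
    show "range (\<lambda>_::nat. \<Pi>\<^sub>E i\<in>I. \<Omega>) \<subseteq> G"
      using E(3) by (auto simp: G_def)
  qed (use S sets eq in \<open>auto simp: G_def Q1.emeasure_eq_measure Q2.emeasure_eq_measure\<close>)
qed

text \<open>The rays of one family are the complements of those of the other. The general type
  covers both \<open>real\<close> and \<open>ereal\<close>.\<close>

lemma sets_borel_eq_sigma_sets_atMost:
  "sets (borel :: 'a::{linorder_topology, second_countable_topology} measure) = sigma_sets UNIV (range atMost)"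
proof -
  have "sets (borel :: 'a measure) = sigma_sets UNIV (range greaterThan)"
    by (subst borel_Ioi) (simp add: sets_measure_of)
  also have "\<dots> = sigma_sets UNIV (range atMost)"
  proof (rule sigma_sets_eqI)
    fix A :: "'a set" assume "A \<in> range greaterThan"
    then obtain x where "A = {x<..}" by blast
    then have "A = UNIV - {..x}" by auto
    then show "A \<in> sigma_sets UNIV (range atMost)"
      by (auto intro: sigma_sets.Compl)
  next
    fix A :: "'a set" assume "A \<in> range atMost"
    then obtain x where "A = {..x}" by blast
    then have "A = UNIV - {x<..}" by auto
    then show "A \<in> sigma_sets UNIV (range greaterThan)"
      by (auto intro: sigma_sets.Compl)
  qed
  finally show ?thesis .
qed

text \<open>The trace of a ray \<open>{..x}\<close> on the unit interval is empty, of the form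
  \<open>{0..x}\<close>, or everything.\<close>

lemma sets_unit_interval_eq_sigma_sets:
  "sets (restrict_space borel {0..1::real}) = sigma_sets {0..1} ((\<lambda>u. {0..u}) ` {0..1})"
proof -
  have "sets (restrict_space borel {0..1::real}) = sigma_sets {0..1} ((\<inter>) {0..1} ` range atMost)"
    unfolding sets_restrict_space sets_borel_eq_sigma_sets_atMost
    by (rule sigma_sets_Int) (auto simp: sets_borel_eq_sigma_sets_atMost[symmetric])
  also have "\<dots> = sigma_sets {0..1} ((\<lambda>u. {0..u}) ` {0..1})"
  proof (rule sigma_sets_eqI)
    fix A :: "real set" assume "A \<in> (\<inter>) {0..1} ` range atMost"
    then obtain x where A: "A = {0..1} \<inter> {..x}" by blast
    consider "x < 0" | "0 \<le> x" "x \<le> 1" | "1 < x" by linarith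
    then show "A \<in> sigma_sets {0..1} ((\<lambda>u. {0..u}) ` {0..1})"
    proof cases
      case 1
      then have "A = {}" using A by auto
      then show ?thesis by (simp add: sigma_sets.Empty)
    next
      case 2
      then have "A = {0..x}" using A by auto
      then show ?thesis using 2 by (auto intro: sigma_sets.Basic)
    next
      case 3
      then have "A = {0..1}" using A by auto
      then show ?thesis by (simp add: sigma_sets_top)
    qed
  next
    fix A :: "real set" assume "A \<in> (\<lambda>u. {0..u}) ` {0..1}"
    then obtain x where "x \<in> {0..1}" "A = {0..x}" by auto
    then have "A = {0..1} \<inter> {..x}" by auto
    then show "A \<in> sigma_sets {0..1} ((\<inter>) {0..1} ` range atMost)"
      by (intro sigma_sets.Basic) blast
  qed
  finally show ?thesis .
qed

text \<open>Reduces the evaluation of the definite description to exhibiting one probability measure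
  with the right values on boxes.\<close>

lemma copula_measure_eqI:
  assumes "prob_space Q"
    and "sets Q = sets (PiM {1..d} (\<lambda>_. restrict_space borel {0..1}))"
    and "\<And>u. u \<in> unit_cube d \<Longrightarrow> measure Q (\<Pi>\<^sub>E k\<in>{1..d}. {0..u k}) = C u"
  shows "copula_measure d C = Q"
  unfolding copula_measure_def
proof (rule the_equality)
  show "prob_space Q \<and> sets Q = sets (PiM {1..d} (\<lambda>_. restrict_space borel {0..1})) \<and>
     (\<forall>u\<in>unit_cube d. measure Q (\<Pi>\<^sub>E k\<in>{1..d}. {0..u k}) = C u)"
    using assms by blast
next
  fix R assume R: "prob_space R \<and> sets R = sets (PiM {1..d} (\<lambda>_. restrict_space borel {0..1})) \<and>
     (\<forall>u\<in>unit_cube d. measure R (\<Pi>\<^sub>E k\<in>{1..d}. {0..u k}) = C u)"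
  show "R = Q"
  proof (rule prob_measure_eqI_PiE[OF _ _ _ _ _ sets_unit_interval_eq_sigma_sets])
    show "Int_stable ((\<lambda>u. {0..u}) ` {0..1::real})"
    proof (rule Int_stableI_image)
      fix i j :: real assume "i \<in> {0..1}" "j \<in> {0..1}"
      then show "\<exists>k\<in>{0..1}. {0..i} \<inter> {0..j} = {0..k}"
        by (intro bexI[of _ "min i j"]) auto
    qed
    fix A assume "A \<in> {1..d} \<rightarrow> (\<lambda>u. {0..u}) ` {0..1::real}"
    then have "\<forall>k\<in>{1..d}. \<exists>u\<in>{0..1}. A k = {0..u}"
      by (auto simp: Pi_iff)
    then obtain u where u: "\<forall>k\<in>{1..d}. u k \<in> {0..1} \<and> A k = {0..u k}"
      by metis
    define v where "v = restrict u {1..d}"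
    have "v \<in> unit_cube d" "Pi\<^sub>E {1..d} A = (\<Pi>\<^sub>E k\<in>{1..d}. {0..v k})"
      using u by (auto simp: v_def unit_cube_def intro!: PiE_cong)
    then show "measure R (Pi\<^sub>E {1..d} A) = measure Q (Pi\<^sub>E {1..d} A)"
      using R assms(3) by auto
  qed (use R assms in auto)
qed

lemma df_measure_eqI:
  assumes "prob_space Q" and "sets Q = sets (ereal_space d)"
    and "\<And>x. x \<in> space (ereal_space d) \<Longrightarrow> measure Q (\<Pi>\<^sub>E k\<in>{1..d}. {..x k}) = H x"
  shows "df_measure d H = Q"
  unfolding df_measure_def
proof (rule the_equality)
  show "prob_space Q \<and> sets Q = sets (ereal_space d) \<and>
     (\<forall>x\<in>space (ereal_space d). measure Q (\<Pi>\<^sub>E k\<in>{1..d}. {..x k}) = H x)"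
    using assms by blast
next
  fix R assume R: "prob_space R \<and> sets R = sets (ereal_space d) \<and>
     (\<forall>x\<in>space (ereal_space d). measure R (\<Pi>\<^sub>E k\<in>{1..d}. {..x k}) = H x)"
  show "R = Q"
  proof (rule prob_measure_eqI_PiE[OF _ _ _ _ _ sets_borel_eq_sigma_sets_atMost])
    show "Int_stable (range atMost :: ereal set set)"
    proof (rule Int_stableI_image)
      fix i j :: ereal
      show "\<exists>k\<in>UNIV. {..i} \<inter> {..j} = {..k}"
        by (intro bexI[of _ "min i j"]) auto
    qed
    \<comment> \<open>The ray \<open>{..\<infinity>}\<close> is all of \<open>ereal\<close>, which
      puts the whole space among the generators.\<close>
    show "(UNIV :: ereal set) \<in> range atMost"
      by (intro image_eqI[of _ _ \<infinity>]) auto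
    fix A assume "A \<in> {1..d} \<rightarrow> (range atMost :: ereal set set)"
    then have "\<forall>k\<in>{1..d}. \<exists>u. A k = {..u}"
      by (auto simp: Pi_iff)
    then obtain u where u: "\<forall>k\<in>{1..d}. A k = {..u k}"
      by metis
    define v where "v = restrict u {1..d}"
    have "v \<in> space (ereal_space d)" "Pi\<^sub>E {1..d} A = (\<Pi>\<^sub>E k\<in>{1..d}. {..v k})"
      using u by (auto simp: v_def space_PiM intro!: PiE_cong)
    then show "measure R (Pi\<^sub>E {1..d} A) = measure Q (Pi\<^sub>E {1..d} A)"
      using R assms(3) by auto
  qed (use R assms in auto)
qed

section \<open>Order statistics\<close>

text \<open>The element type is any linear order, so that one notion serves the real sample and the
  extended real vectors of \<open>order_map\<close>.\<close>

definition ordstat :: "nat \<Rightarrow> (nat \<Rightarrow> 'a::linorder) \<Rightarrow> nat \<Rightarrow> 'a" where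
  "ordstat d x k = Min {Max (x ` J) | J. J \<subseteq> {1..d} \<and> card J = k}"

text \<open>A \<open>k\<close>-element \<open>J\<close> has maximum at most \<open>t\<close> iff it
  lies inside the set of indices with \<open>x i \<le> t\<close>. This counting form links order
  statistics to \<open>ballot\<close>.\<close>

lemma ordstat_le_iff:
  assumes k: "k \<in> {1..d}"
  shows "ordstat d x k \<le> t \<longleftrightarrow> k \<le> card {i\<in>{1..d}. x i \<le> t}"
proof -
  let ?F = "{J. J \<subseteq> {1..d} \<and> card J = k}"
  have eq: "{Max (x ` J) | J. J \<subseteq> {1..d} \<and> card J = k} = (\<lambda>J. Max (x ` J)) ` ?F"
    by auto
  have "{1..k} \<in> ?F" using k by auto
  then have "(\<lambda>J. Max (x ` J)) ` ?F \<noteq> {}" by blast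
  then have "ordstat d x k \<le> t \<longleftrightarrow> (\<exists>J\<in>?F. Max (x ` J) \<le> t)"
    unfolding ordstat_def eq by (subst Min_le_iff) auto
  also have "\<dots> \<longleftrightarrow> (\<exists>J\<in>?F. J \<subseteq> {i\<in>{1..d}. x i \<le> t})"
  proof (intro bex_cong refl)
    fix J assume J: "J \<in> ?F"
    then have "finite J" "J \<noteq> {}" using k by (auto intro: finite_subset)
    then show "Max (x ` J) \<le> t \<longleftrightarrow> J \<subseteq> {i\<in>{1..d}. x i \<le> t}"
      using J by auto
  qed
  also have "\<dots> \<longleftrightarrow> k \<le> card {i\<in>{1..d}. x i \<le> t}"
  proof
    assume "\<exists>J\<in>?F. J \<subseteq> {i\<in>{1..d}. x i \<le> t}"
    then show "k \<le> card {i\<in>{1..d}. x i \<le> t}"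
      by (auto intro!: card_mono)
  next
    assume "k \<le> card {i\<in>{1..d}. x i \<le> t}"
    then obtain J where "J \<subseteq> {i\<in>{1..d}. x i \<le> t}" "card J = k"
      by (rule obtain_subset_with_card_n)
    then show "\<exists>J\<in>?F. J \<subseteq> {i\<in>{1..d}. x i \<le> t}"
      by (intro bexI[of _ J]) auto
  qed
  finally show ?thesis .
qed

lemma ordstat_eqI:
  assumes "k \<in> {1..d}" "\<And>t. y \<le> t \<longleftrightarrow> k \<le> card {i\<in>{1..d}. x i \<le> t}"
  shows "ordstat d x k = y"
  using assms(2)[of "ordstat d x k"] assms(2)[of y] ordstat_le_iff[OF assms(1), of x]
  by (auto intro: antisym)

text \<open>The embedding is increasing, so counting below a level is unaffected. It transfers
  \<open>order_map\<close> from extended reals to the real sample.\<close>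

lemma ordstat_ereal:
  assumes k: "k \<in> {1..d}"
  shows "ordstat d (\<lambda>i. ereal (x i)) k = ereal (ordstat d x k)"
proof (rule ordstat_eqI[OF k])
  fix t :: ereal
  show "ereal (ordstat d x k) \<le> t \<longleftrightarrow> k \<le> card {i\<in>{1..d}. ereal (x i) \<le> t}"
  proof (cases t)
    case PInf
    then have "{i\<in>{1..d}. ereal (x i) \<le> t} = {1..d}" by auto
    with PInf k show ?thesis by simp
  qed (use k in \<open>auto simp: ordstat_le_iff\<close>)
qed

lemma ordstat_cong:
  assumes "\<And>i. i \<in> {1..d} \<Longrightarrow> x i = y i"
  shows "ordstat d x k = ordstat d y k"
proof -
  have "x ` J = y ` J" if "J \<subseteq> {1..d}" for J
    using that assms by (intro image_cong) auto
  then show ?thesis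
    unfolding ordstat_def by (intro arg_cong[where f=Min]) metis
qed

lemma order_map_eq: "order_map d x = (\<lambda>k\<in>{1..d}. ordstat d x k)"
  by (simp add: order_map_def ordstat_def)

lemma measurable_ordstat:
  fixes f :: "nat \<Rightarrow> 'b \<Rightarrow> 'a::{linorder_topology, second_countable_topology}"
  assumes k: "k \<in> {1..d}" and f [measurable]: "\<And>i. i \<in> {1..d} \<Longrightarrow> f i \<in> borel_measurable M"
  shows "(\<lambda>w. ordstat d (\<lambda>i. f i w) k) \<in> borel_measurable M"
proof (rule borel_measurableI_le)
  fix t :: 'a
  have [measurable]: "(\<lambda>w. card {i\<in>{1..d}. f i w \<le> t}) \<in> measurable M (count_space UNIV)"
    by (rule measurable_card_le) auto
  show "{w\<in>space M. ordstat d (\<lambda>i. f i w) k \<le> t} \<in> sets M"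
    unfolding ordstat_le_iff[OF k] by measurable
qed

section \<open>Independent uniform variables as a model of the product copula\<close>

abbreviation iid :: "nat \<Rightarrow> (nat \<Rightarrow> real) measure" where
  "iid d \<equiv> PiM {1..d} (\<lambda>_. unif)"

lemma measurable_ordstat_iid [measurable (raw)]:
  "k \<in> {1..d} \<Longrightarrow> (\<lambda>u. ordstat d u k) \<in> borel_measurable (iid d)"
  using measurable_ordstat[of k d "\<lambda>i u. u i" "iid d"] by (simp add: measurable_component_unif)

lemma measurable_order_map: "order_map d \<in> measurable (ereal_space d) (ereal_space d)"
proof -
  have "(\<lambda>x. ordstat d (\<lambda>i. x i) k) \<in> borel_measurable (ereal_space d)" if "k \<in> {1..d}" for k
    using that by (intro measurable_ordstat) auto
  then show ?thesis
    unfolding order_map_eq[abs_def] by (intro measurable_restrict) auto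
qed

text \<open>This is both the distribution function of \<open>unif\<close> and the retraction of the
  line onto the unit interval.\<close>

definition clip :: "real \<Rightarrow> real" where
  "clip x = max 0 (min x 1)"

lemma measurable_clip [measurable]: "clip \<in> borel_measurable borel"
  unfolding clip_def[abs_def] by measurable

lemma clip_bounds: "clip x \<in> {0..1}"
  by (auto simp: clip_def)

lemma measure_unif_atMost: "measure unif {..t} = clip t"
proof -
  have "{0..1} \<inter> {..t} = {0..min 1 t}" by auto
  then have "measure unif {..t} = enn2real (emeasure lborel {0..min 1 t})"
    unfolding measure_def by (subst emeasure_unif) simp_all
  then show ?thesis
    by (simp add: emeasure_lborel_Icc_eq clip_def min_def max_def)
qed

lemma measure_iid_box:
  assumes "\<And>k. k \<in> {1..d} \<Longrightarrow> A k \<in> sets borel"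
  shows "measure (iid d) (Pi\<^sub>E {1..d} A) = (\<Prod>k=1..d. measure unif (A k))"
proof -
  interpret finite_product_prob_space "\<lambda>_. unif" "{1..d}" by standard auto
  show ?thesis using assms by (intro prob_times) auto
qed

text \<open>By independence the probability of a box is the product of the truncated bounds; the
  infinite bounds give the factors \<open>0\<close> and \<open>1\<close>.\<close>

lemma df_measure_product_copula:
  "df_measure d (copula_df d (product_copula d)) =
    distr (iid d) (ereal_space d) (\<lambda>u. \<lambda>k\<in>{1..d}. ereal (u k))" (is "_ = distr _ _ ?E")
proof (rule df_measure_eqI)
  have [measurable]: "?E \<in> measurable (iid d) (ereal_space d)"
    by (intro measurable_restrict borel_measurable_ereal measurable_component_unif)
  show "prob_space (distr (iid d) (ereal_space d) ?E)"
    by (intro prob_space.prob_space_distr prob_space_PiM_unif) measurable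
  fix x assume x: "x \<in> space (ereal_space d)"
  have "measure (distr (iid d) (ereal_space d) ?E) (\<Pi>\<^sub>E k\<in>{1..d}. {..x k}) =
    measure (iid d) (?E -` (\<Pi>\<^sub>E k\<in>{1..d}. {..x k}) \<inter> space (iid d))"
    by (intro measure_distr) (auto intro!: sets_PiM_I_finite)
  also have "?E -` (\<Pi>\<^sub>E k\<in>{1..d}. {..x k}) \<inter> space (iid d) = (\<Pi>\<^sub>E k\<in>{1..d}. {s. ereal s \<le> x k})"
    by (auto simp: space_PiM PiE_iff)
  also have "measure (iid d) \<dots> = (\<Prod>k=1..d. measure unif {s. ereal s \<le> x k})"
    by (rule measure_iid_box) auto
  also have "\<dots> = (\<Prod>k=1..d. real_of_ereal (max 0 (min (x k) 1)))"
  proof (rule prod.cong[OF refl])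
    fix k
    show "measure unif {s. ereal s \<le> x k} = real_of_ereal (max 0 (min (x k) 1))"
    proof (cases "x k")
      case (real r)
      then have "{s. ereal s \<le> x k} = {..r}" by auto
      moreover have "max 0 (min (x k) 1) = ereal (clip r)"
        using real by (auto simp: clip_def max_def min_def one_ereal_def zero_ereal_def)
      ultimately show ?thesis by (simp add: measure_unif_atMost)
    next
      case PInf
      then show ?thesis using unif.prob_space by simp
    next
      case MInf
      then show ?thesis by simp
    qed
  qed
  also have "\<dots> = copula_df d (product_copula d) x"
  proof -
    have "real_of_ereal (max 0 (min (x k) 1)) \<in> {0..1}" for k
      by (cases "x k") (auto simp: max_def min_def one_ereal_def zero_ereal_def)
    then have "(\<lambda>k\<in>{1..d}. real_of_ereal (max 0 (min (x k) 1))) \<in> unit_cube d"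
      by (auto simp: unit_cube_def)
    then show ?thesis
      by (simp add: copula_df_def product_copula_def)
  qed
  finally show "measure (distr (iid d) (ereal_space d) ?E) (\<Pi>\<^sub>E k\<in>{1..d}. {..x k}) =
    copula_df d (product_copula d) x" .
qed simp

lemma order_df_product_copula:
  "order_df d (product_copula d) x =
    measure (iid d) {u\<in>space (iid d). \<forall>k\<in>{1..d}. ereal (ordstat d u k) \<le> x k}"
proof -
  let ?E = "\<lambda>u::nat\<Rightarrow>real. \<lambda>k\<in>{1..d}. ereal (u k)"
  have E [measurable]: "?E \<in> measurable (iid d) (ereal_space d)"
    by (intro measurable_restrict borel_measurable_ereal measurable_component_unif)
  have os: "ordstat d (?E u) k = ereal (ordstat d u k)" if "k \<in> {1..d}" for u k
    using ordstat_ereal[OF that, of u] ordstat_cong[of d "?E u" "\<lambda>i. ereal (u i)" k] by simp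
  have "order_df d (product_copula d) x =
    measure (distr (iid d) (ereal_space d) (order_map d \<circ> ?E)) (\<Pi>\<^sub>E k\<in>{1..d}. {..x k})"
    unfolding order_df_def df_measure_product_copula by (subst distr_distr[OF measurable_order_map E]) simp
  also have "\<dots> = measure (iid d) ((order_map d \<circ> ?E) -` (\<Pi>\<^sub>E k\<in>{1..d}. {..x k}) \<inter> space (iid d))"
    by (rule measure_distr[OF measurable_comp[OF E measurable_order_map]]) (auto intro!: sets_PiM_I_finite)
  also have "(order_map d \<circ> ?E) -` (\<Pi>\<^sub>E k\<in>{1..d}. {..x k}) \<inter> space (iid d)
    = {u\<in>space (iid d). \<forall>k\<in>{1..d}. ereal (ordstat d u k) \<le> x k}"
    using os by (auto simp: order_map_eq PiE_iff)
  finally show ?thesis .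
qed

section \<open>The order transform of the product copula\<close>

lemma AE_iid_Ioo: "AE u in iid d. \<forall>i\<in>{1..d}. u i \<in> {0<..<1}"
  by (intro AE_finite_allI AE_PiM_component[of _ "\<lambda>_. unif"] prob_space_unif AE_unif_Ioo) auto

lemma measure_iid_component:
  assumes "i \<in> {1..d}" "A \<in> sets borel"
  shows "measure (iid d) {u\<in>space (iid d). u i \<in> A} = measure unif A"
proof -
  have "measure unif A = measure (distr (iid d) unif (\<lambda>u. u i)) A"
    using assms by (subst unif_prod.PiM_component) auto
  also have "\<dots> = measure (iid d) ((\<lambda>u. u i) -` A \<inter> space (iid d))"
    using assms by (intro measure_distr) (auto intro: measurable_component_singleton)
  also have "(\<lambda>u. u i) -` A \<inter> space (iid d) = {u\<in>space (iid d). u i \<in> A}" by auto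
  finally show ?thesis ..
qed

section \<open>Distribution functions of the single order statistics\<close>

definition ordstat_cdf :: "nat \<Rightarrow> nat \<Rightarrow> ereal \<Rightarrow> real" where
  "ordstat_cdf d k t = measure (iid d) {u\<in>space (iid d). ereal (ordstat d u k) \<le> t}"

lemma sets_ordstat_le: "k \<in> {1..d} \<Longrightarrow> {u\<in>space (iid d). ereal (ordstat d u k) \<le> t} \<in> sets (iid d)"
  by measurable

lemma ordstat_cdf_bounds: "ordstat_cdf d k t \<in> {0..1}"
  unfolding ordstat_cdf_def using prob_space.prob_le_1[OF prob_space_PiM_unif] by auto

lemma ordstat_cdf_mono:
  assumes "k \<in> {1..d}" "s \<le> t"
  shows "ordstat_cdf d k s \<le> ordstat_cdf d k t"
proof -
  show ?thesis
    unfolding ordstat_cdf_def using assms(2)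
    by (intro unif_prod.finite_measure_mono sets_ordstat_le[OF assms(1)]) (auto intro: order_trans)
qed

lemma ordstat_cdf_infinity: "ordstat_cdf d k \<infinity> = 1"
  unfolding ordstat_cdf_def using prob_space.prob_space[OF prob_space_PiM_unif, of "{1..d}"] by simp

text \<open>Counting at the two endpoints: almost surely no point is at most \<open>0\<close> and
  all points are at most \<open>1\<close>.\<close>

lemma AE_ordstat_bounds:
  "AE u in iid d. \<forall>k\<in>{1..d}. ordstat d u k \<in> {0<..1}"
  using AE_iid_Ioo[of d]
proof eventually_elim
  case (elim u)
  then have eq: "{i\<in>{1..d}. u i \<le> 0} = {}" "{i\<in>{1..d}. u i \<le> 1} = {1..d}"
    by force+
  show ?case
  proof
    fix k assume k: "k \<in> {1..d}"
    have "\<not> ordstat d u k \<le> 0" "ordstat d u k \<le> 1"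
      unfolding ordstat_le_iff[OF k] eq using k by simp_all
    then show "ordstat d u k \<in> {0<..1}" by simp
  qed
qed

lemma ordstat_cdf_0: 
  assumes "k \<in> {1..d}"
  shows "ordstat_cdf d k (ereal 0) = 0"
proof -
  have "AE u in iid d. \<not> ereal (ordstat d u k) \<le> ereal 0"
    using AE_ordstat_bounds by eventually_elim (use assms in force)
  then have "emeasure (iid d) {u\<in>space (iid d). \<not> \<not> ereal (ordstat d u k) \<le> ereal 0} = 0"
    using sets_ordstat_le[OF assms, of "ereal 0"] by (subst (asm) AE_iff_measurable[OF _ refl]) auto
  then show ?thesis
    by (simp add: ordstat_cdf_def measure_def)
qed

lemma ordstat_cdf_1:
  assumes "k \<in> {1..d}"
  shows "ordstat_cdf d k (ereal 1) = 1"
proof -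
  have "AE u in iid d. ereal (ordstat d u k) \<le> ereal 1"
    using AE_ordstat_bounds by eventually_elim (use assms in auto)
  then show ?thesis
    unfolding ordstat_cdf_def using sets_ordstat_le[OF assms, of "ereal 1"]
    by (subst unif_prod.prob_Collect_eq_1) auto
qed

text \<open>If the order statistic lies in \<open>{s<..t}\<close>, then so does one of the
  \<open>d\<close> points, each with probability at most \<open>t - s\<close>. This supplies the
  continuity of the marginals.\<close>

lemma ordstat_cdf_Lipschitz:
  assumes k: "k \<in> {1..d}" and "s \<le> t"
  shows "ordstat_cdf d k (ereal t) \<le> ordstat_cdf d k (ereal s) + real d * (t - s)"
proof -
  let ?S = "\<lambda>i. {u\<in>space (iid d). u i \<in> {s<..t}}"
  have S: "?S i \<in> sets (iid d)" if "i \<in> {1..d}" for i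
    using that by measurable
  have "ordstat d u k \<le> s" if "ordstat d u k \<le> t" "\<forall>i\<in>{1..d}. u i \<notin> {s<..t}" for u :: "nat \<Rightarrow> real"
  proof -
    have "{i\<in>{1..d}. u i \<le> t} = {i\<in>{1..d}. u i \<le> s}"
      using that(2) \<open>s \<le> t\<close> by force
    then show ?thesis using that(1) by (simp add: ordstat_le_iff[OF k])
  qed
  then have sub: "{u\<in>space (iid d). ereal (ordstat d u k) \<le> ereal t} \<subseteq>
      {u\<in>space (iid d). ereal (ordstat d u k) \<le> ereal s} \<union> (\<Union>i\<in>{1..d}. ?S i)"
    by (auto simp del: atLeastAtMost_iff)
  have "ordstat_cdf d k (ereal t) \<le>
      measure (iid d) ({u\<in>space (iid d). ereal (ordstat d u k) \<le> ereal s} \<union> (\<Union>i\<in>{1..d}. ?S i))"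
    unfolding ordstat_cdf_def
    by (rule unif_prod.finite_measure_mono[OF sub])
      (intro sets.Un sets.finite_UN sets_ordstat_le[OF k] S finite_atLeastAtMost)
  also have "\<dots> \<le> ordstat_cdf d k (ereal s) + measure (iid d) (\<Union>i\<in>{1..d}. ?S i)"
    unfolding ordstat_cdf_def
    by (intro measure_Un_le sets.finite_UN sets_ordstat_le[OF k] S finite_atLeastAtMost)
  also have "measure (iid d) (\<Union>i\<in>{1..d}. ?S i) \<le> (\<Sum>i\<in>{1..d}. measure (iid d) (?S i))"
    using S by (intro measure_UNION_le) auto
  also have "\<dots> \<le> (\<Sum>i\<in>{1..d}. t - s)"
  proof (rule sum_mono)
    fix i assume "i \<in> {1..d}"
    then have "measure (iid d) (?S i) = measure unif {s<..t}"
      by (intro measure_iid_component) auto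
    also have "\<dots> = measure lborel ({0..1} \<inter> {s<..t})"
      by (simp add: measure_def emeasure_unif)
    also have "\<dots> \<le> measure lborel {s<..t}"
      using \<open>s \<le> t\<close> by (intro measure_mono_fmeasurable) (auto simp: fmeasurable_def)
    also have "\<dots> = t - s"
      using \<open>s \<le> t\<close> by simp
    finally show "measure (iid d) (?S i) \<le> t - s" .
  qed
  finally show ?thesis by simp
qed

text \<open>With the positive probability \<open>(t - s) ^ d\<close> all points, hence all order
  statistics, fall into \<open>{s<..t}\<close>.\<close>

lemma ordstat_cdf_strict_mono:
  assumes k: "k \<in> {1..d}" and "0 \<le> s" "s < t" "t \<le> 1"
  shows "ordstat_cdf d k (ereal s) < ordstat_cdf d k (ereal t)"
proof -
  let ?B = "Pi\<^sub>E {1..d} (\<lambda>_. {s<..t})"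
  let ?S = "\<lambda>s. {u\<in>space (iid d). ereal (ordstat d u k) \<le> ereal s}"
  have "{0..1} \<inter> {s<..t} = {s<..t}" using assms by auto
  then have "measure unif {s<..t} = t - s"
    using assms by (simp add: measure_def emeasure_unif)
  then have "measure (iid d) ?B = (t - s) ^ d"
    using measure_iid_box[of d "\<lambda>_. {s<..t}"] by simp
  then have pos: "0 < measure (iid d) ?B" using assms by simp
  have B: "?B \<in> sets (iid d)" by (intro sets_PiM_I_finite) auto
  have "u \<in> ?S t \<and> u \<notin> ?S s" if u: "u \<in> ?B" for u
  proof -
    have eq: "{i\<in>{1..d}. u i \<le> t} = {1..d}" "{i\<in>{1..d}. u i \<le> s} = {}"
      using u by (force simp: PiE_iff)+
    have "ordstat d u k \<le> t" "\<not> ordstat d u k \<le> s"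
      unfolding ordstat_le_iff[OF k] eq using k by simp_all
    then show ?thesis
      using u by (auto simp: space_PiM PiE_iff)
  qed
  then have disj: "?S s \<inter> ?B = {}" and sub: "?S s \<union> ?B \<subseteq> ?S t"
    using \<open>s < t\<close> by auto
  have "measure (iid d) (?S s) + measure (iid d) ?B = measure (iid d) (?S s \<union> ?B)"
    by (rule unif_prod.finite_measure_Union[OF sets_ordstat_le[OF k] B disj, symmetric])
  also have "\<dots> \<le> measure (iid d) (?S t)"
    by (rule unif_prod.finite_measure_mono[OF sub sets_ordstat_le[OF k]])
  finally have "measure (iid d) (?S s) + measure (iid d) ?B \<le> measure (iid d) (?S t)" .
  with pos show ?thesis
    unfolding ordstat_cdf_def by simp
qed

text \<open>Intermediate value theorem on the unit interval, with the values \<open>0\<close> and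
  \<open>1\<close> at its ends.\<close>

lemma ordstat_cdf_surj:
  assumes k: "k \<in> {1..d}" and v: "v \<in> {0..1}"
  obtains s where "ordstat_cdf d k (ereal s) = v"
proof -
  let ?F = "\<lambda>s. ordstat_cdf d k (ereal s)"
  have "dist (?F x) (?F y) \<le> real d * dist x y" for x y
  proof (cases x y rule: linorder_le_cases)
    case le
    then show ?thesis
      using ordstat_cdf_Lipschitz[OF k le] ordstat_cdf_mono[OF k, of "ereal x" "ereal y"]
      by (simp add: dist_real_def)
  next
    case ge
    then show ?thesis
      using ordstat_cdf_Lipschitz[OF k ge] ordstat_cdf_mono[OF k, of "ereal y" "ereal x"]
      by (simp add: dist_real_def)
  qed
  then have "continuous_on {0..1} ?F"
    by (intro lipschitz_on_continuous_on[of "real d"] lipschitz_onI) auto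
  then have "\<exists>x\<ge>0. x \<le> 1 \<and> ?F x = v"
    using v ordstat_cdf_0[OF k] ordstat_cdf_1[OF k] by (intro IVT') auto
  then show ?thesis using that by auto
qed

text \<open>Every point of the cube is a vector of marginal values. Hence the factorisation through
  the marginals determines a copula on the whole cube.\<close>

lemma unit_cube_cdf_surj:
  assumes u: "u \<in> unit_cube d"
  obtains x where "x \<in> space (ereal_space d)" "u = (\<lambda>k\<in>{1..d}. ordstat_cdf d k (x k))"
proof -
  have "\<forall>k\<in>{1..d}. \<exists>s. ordstat_cdf d k (ereal s) = u k"
    using u ordstat_cdf_surj by (metis PiE_mem unit_cube_def)
  then obtain s where s: "\<forall>k\<in>{1..d}. ordstat_cdf d k (ereal (s k)) = u k"
    by metis
  show ?thesis
  proof
    show "(\<lambda>k\<in>{1..d}. ereal (s k)) \<in> space (ereal_space d)"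
      by (simp add: space_PiM)
    have "u \<in> extensional {1..d}"
      using u by (auto simp: unit_cube_def PiE_def)
    then show "u = (\<lambda>k\<in>{1..d}. ordstat_cdf d k ((\<lambda>k\<in>{1..d}. ereal (s k)) k))"
      using s by (intro ext) (auto simp: extensional_def)
  qed
qed

section \<open>The sorted sample after the marginal probability integral transforms, and its
  distribution function\<close>

definition ordstat_ranks :: "nat \<Rightarrow> (nat \<Rightarrow> real) \<Rightarrow> nat \<Rightarrow> real" where
  "ordstat_ranks d w = (\<lambda>k\<in>{1..d}. ordstat_cdf d k (ereal (ordstat d w k)))"

definition ordstat_copula :: "nat \<Rightarrow> (nat \<Rightarrow> real) \<Rightarrow> real" where
  "ordstat_copula d = (\<lambda>u\<in>unit_cube d.
     measure (iid d) {w\<in>space (iid d). \<forall>k\<in>{1..d}. ordstat_ranks d w k \<le> u k})"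

lemma ordstat_ranks_in_unit_cube: "ordstat_ranks d w \<in> unit_cube d"
  using ordstat_cdf_bounds by (auto simp: ordstat_ranks_def unit_cube_def)

lemma measurable_ordstat_ranks [measurable (raw)]:
  assumes "k \<in> {1..d}"
  shows "(\<lambda>w. ordstat_ranks d w k) \<in> borel_measurable (iid d)"
proof -
  have [measurable]: "(\<lambda>s. ordstat_cdf d k (ereal s)) \<in> borel_measurable borel"
    using assms by (intro borel_measurable_mono monoI ordstat_cdf_mono) auto
  have [measurable]: "(\<lambda>w. ordstat d w k) \<in> borel_measurable (iid d)"
    using assms by (rule measurable_ordstat_iid)
  have "(\<lambda>w. ordstat_cdf d k (ereal (ordstat d w k))) \<in> borel_measurable (iid d)"
    by measurable
  then show ?thesis using assms by (simp add: ordstat_ranks_def)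
qed

text \<open>One direction is monotonicity; the other is strict growth on the unit interval, where
  almost surely all order statistics lie.\<close>

lemma AE_ordstat_ranks_le_iff:
  "AE w in iid d. \<forall>k\<in>{1..d}. \<forall>t. ordstat_ranks d w k \<le> ordstat_cdf d k t \<longleftrightarrow> ereal (ordstat d w k) \<le> t"
  using AE_ordstat_bounds[of d]
proof eventually_elim
  case (elim w)
  show ?case
  proof (intro ballI allI)
    fix k t assume k: "k \<in> {1..d}"
    let ?s = "ordstat d w k"
    have s: "0 < ?s" "?s \<le> 1" using elim k by auto
    have "ordstat_cdf d k t < ordstat_cdf d k (ereal ?s)" if "t < ereal ?s"
    proof -
      \<comment> \<open>Strict growth is available only from \<open>0\<close> on, so
        \<open>t\<close> is first raised to a finite \<open>r \<ge> 0\<close>; as \<open>?s\<close>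
        is positive, \<open>r\<close> stays below it.\<close>
      define r where "r = max 0 (real_of_ereal t)"
      have r: "t \<le> ereal r" "0 \<le> r" "r < ?s"
        using that s by (cases t; auto simp: r_def)+
      have "ordstat_cdf d k t \<le> ordstat_cdf d k (ereal r)"
        using k r(1) by (rule ordstat_cdf_mono)
      also have "\<dots> < ordstat_cdf d k (ereal ?s)"
        using k r(2,3) s(2) by (rule ordstat_cdf_strict_mono)
      finally show ?thesis .
    qed
    then show "ordstat_ranks d w k \<le> ordstat_cdf d k t \<longleftrightarrow> ereal (ordstat d w k) \<le> t"
      using k ordstat_cdf_mono[OF k, of "ereal ?s" t]
      by (auto simp: ordstat_ranks_def simp flip: not_less)
  qed
qed

text \<open>The two events agree almost surely. This is the factorisation that the order transform
  has to satisfy.\<close>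

lemma order_df_eq_ordstat_copula:
  "order_df d (product_copula d) x = ordstat_copula d (\<lambda>k\<in>{1..d}. ordstat_cdf d k (x k))"
proof -
  have "(\<lambda>k\<in>{1..d}. ordstat_cdf d k (x k)) \<in> unit_cube d"
    using ordstat_cdf_bounds by (auto simp: unit_cube_def)
  then have "ordstat_copula d (\<lambda>k\<in>{1..d}. ordstat_cdf d k (x k)) =
      measure (iid d) {w\<in>space (iid d). \<forall>k\<in>{1..d}. ordstat_ranks d w k \<le> ordstat_cdf d k (x k)}"
    by (simp add: ordstat_copula_def)
  also have "\<dots> = measure (iid d) {u\<in>space (iid d). \<forall>k\<in>{1..d}. ereal (ordstat d u k) \<le> x k}"
  proof (rule unif_prod.finite_measure_eq_AE)
    show "AE w in iid d. w \<in> {w\<in>space (iid d). \<forall>k\<in>{1..d}. ordstat_ranks d w k \<le> ordstat_cdf d k (x k)}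
        \<longleftrightarrow> w \<in> {u\<in>space (iid d). \<forall>k\<in>{1..d}. ereal (ordstat d u k) \<le> x k}"
      by (rule eventually_mono[OF AE_ordstat_ranks_le_iff]) auto
  qed measurable
  finally show ?thesis
    by (simp add: order_df_product_copula)
qed

lemma marginal_df_order_df:
  assumes "k \<in> {1..d}"
  shows "marginal_df d (order_df d (product_copula d)) k t = ordstat_cdf d k t"
proof -
  have "{u\<in>space (iid d). \<forall>j\<in>{1..d}. ereal (ordstat d u j) \<le> (\<lambda>j\<in>{1..d}. if j = k then t else \<infinity>) j}
    = {u\<in>space (iid d). ereal (ordstat d u k) \<le> t}"
    using assms by auto
  then show ?thesis
    by (simp add: marginal_df_def order_df_product_copula ordstat_cdf_def)
qed

lemma order_df_le_ordstat_cdf: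
  assumes "k \<in> {1..d}"
  shows "order_df d (product_copula d) x \<le> ordstat_cdf d k (x k)"
proof -
  show ?thesis
    unfolding order_df_product_copula ordstat_cdf_def
    using assms sets_ordstat_le[OF assms, of "x k"] by (intro unif_prod.finite_measure_mono) auto
qed

text \<open>The product form of the integrand lets an alternating sum over the vertices of a box be
  factorised under the integral.\<close>

lemma ordstat_copula_eq_integral:
  assumes "u \<in> unit_cube d"
  shows "ordstat_copula d u = (\<integral>w. (\<Prod>k=1..d. indicator {..u k} (ordstat_ranks d w k)) \<partial>iid d)"
proof -
  have "(\<Prod>k=1..d. indicator {..u k} (ordstat_ranks d w k)) =
    (indicator {w. \<forall>k\<in>{1..d}. ordstat_ranks d w k \<le> u k} w :: real)" for w
    by (auto split: split_indicator simp: prod_zero_iff simp del: atLeastAtMost_iff)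
  moreover have "{w. \<forall>k\<in>{1..d}. ordstat_ranks d w k \<le> u k} \<inter> space (iid d) =
    {w\<in>space (iid d). \<forall>k\<in>{1..d}. ordstat_ranks d w k \<le> u k}" by auto
  ultimately show ?thesis
    using assms by (simp add: ordstat_copula_def)
qed

lemma integrable_prod_indicator:
  "integrable (iid d) (\<lambda>w. \<Prod>k=1..d. indicator {..u k} (ordstat_ranks d w k) :: real)"
proof -
  show ?thesis
  proof (rule unif_prod.integrable_const_bound[of _ 1])
    show "AE w in iid d. norm (\<Prod>k=1..d. indicator {..u k} (ordstat_ranks d w k) :: real) \<le> 1"
      by (auto intro!: AE_I2 prod_le_1 simp: abs_prod)
  qed measurable
qed

lemma is_copula_ordstat_copula: "is_copula d (ordstat_copula d)"
  unfolding is_copula_def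
proof (intro conjI ballI impI)
  show "ordstat_copula d \<in> unit_cube d \<rightarrow>\<^sub>E {0..1}"
    using prob_space.prob_le_1[OF prob_space_PiM_unif] by (auto simp: ordstat_copula_def)
next
  fix u assume u: "u \<in> unit_cube d" and "\<exists>k\<in>{1..d}. u k = 0"
  then obtain k where k: "k \<in> {1..d}" "u k = 0" by blast
  obtain x where x: "u = (\<lambda>k\<in>{1..d}. ordstat_cdf d k (x k))"
    using unit_cube_cdf_surj[OF u] by blast
  \<comment> \<open>A joint probability is at most the \<open>k\<close>-th marginal one, which here
    is \<open>u k = 0\<close>.\<close>
  have "ordstat_copula d u \<le> ordstat_cdf d k (x k)"
    using order_df_le_ordstat_cdf[OF k(1), of x] by (simp add: order_df_eq_ordstat_copula x)
  also have "\<dots> = 0" using k x by simp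
  finally show "ordstat_copula d u = 0"
    using u by (simp add: ordstat_copula_def order_antisym)
next
  fix k and t :: real assume k: "k \<in> {1..d}" and t: "t \<in> {0..1}"
  obtain s where s: "ordstat_cdf d k (ereal s) = t"
    using ordstat_cdf_surj[OF k t] .
  \<comment> \<open>The coordinates \<open>1\<close> are the marginal values at
    \<open>\<infinity>\<close>, so the point is a vector of marginal values.\<close>
  have "(\<lambda>j\<in>{1..d}. if j = k then t else 1) =
      (\<lambda>j\<in>{1..d}. ordstat_cdf d j ((\<lambda>j\<in>{1..d}. if j = k then ereal s else \<infinity>) j))"
    by (auto simp: fun_eq_iff s ordstat_cdf_infinity)
  then show "ordstat_copula d (\<lambda>j\<in>{1..d}. if j = k then t else 1) = t"
    using marginal_df_order_df[OF k, of "ereal s"]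
    by (simp only: order_df_eq_ordstat_copula[symmetric] marginal_df_def s)
next
  fix a b assume a: "a \<in> unit_cube d" and b: "b \<in> unit_cube d" and ab: "\<forall>k\<in>{1..d}. a k \<le> b k"
  let ?c = "\<lambda>J. \<lambda>k\<in>{1..d}. if k \<in> J then a k else b k"
  let ?f = "\<lambda>u w k. indicator {..u k} (ordstat_ranks d w k) :: real"
  have c: "?c J \<in> unit_cube d" for J
    using a b by (auto simp: unit_cube_def PiE_iff)
  have "(\<Sum>J\<in>Pow {1..d}. (- 1) ^ card J * ordstat_copula d (?c J)) =
     (\<integral>w. (\<Sum>J\<in>Pow {1..d}. (- 1) ^ card J * (\<Prod>k=1..d. ?f (?c J) w k)) \<partial>iid d)"
    unfolding ordstat_copula_eq_integral[OF c]
    using integrable_prod_indicator[of d "?c J" for J]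
    by (subst Bochner_Integration.integral_sum) (auto simp del: restrict_apply)
  \<comment> \<open>The sum over vertices is the expansion of a product of differences, each
    nonnegative because \<open>a k \<le> b k\<close>.\<close>
  also have "\<dots> = (\<integral>w. (\<Prod>k=1..d. ?f b w k - ?f a w k) \<partial>iid d)"
  proof (rule Bochner_Integration.integral_cong[OF refl])
    fix w
    have "(\<Prod>k=1..d. ?f (?c J) w k) = (\<Prod>k\<in>J. ?f a w k) * (\<Prod>k\<in>{1..d} - J. ?f b w k)"
      if "J \<in> Pow {1..d}" for J
    proof -
      have "(\<Prod>k=1..d. ?f (?c J) w k) = (\<Prod>k\<in>J. ?f (?c J) w k) * (\<Prod>k\<in>{1..d} - J. ?f (?c J) w k)"
        using that prod.subset_diff[of J "{1..d}" "?f (?c J) w"] by (simp add: mult.commute)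
      also have "(\<Prod>k\<in>J. ?f (?c J) w k) = (\<Prod>k\<in>J. ?f a w k)"
        using that by (intro prod.cong) auto
      also have "(\<Prod>k\<in>{1..d} - J. ?f (?c J) w k) = (\<Prod>k\<in>{1..d} - J. ?f b w k)"
        by (intro prod.cong) auto
      finally show ?thesis .
    qed
    then show "(\<Sum>J\<in>Pow {1..d}. (- 1) ^ card J * (\<Prod>k=1..d. ?f (?c J) w k)) = (\<Prod>k=1..d. ?f b w k - ?f a w k)"
      by (subst prod_diff_conv_sum) (auto simp: mult.assoc intro!: sum.cong)
  qed
  also have "\<dots> \<ge> 0"
    using ab by (intro integral_nonneg_AE AE_I2 prod_nonneg) (force split: split_indicator)
  finally show "0 \<le> (\<Sum>J\<in>Pow {1..d}. (- 1) ^ card J * ordstat_copula d (?c J))" .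
qed

text \<open>Existence is the factorisation of \<open>order_df\<close>. Uniqueness holds because the
  marginal values fill the cube and copulas are extensional on it.\<close>

lemma order_transform_product_copula:
  "order_transform d (product_copula d) = ordstat_copula d"
  unfolding order_transform_def
proof (rule the_equality)
  have eq: "(\<lambda>k\<in>{1..d}. marginal_df d (order_df d (product_copula d)) k (x k)) =
    (\<lambda>k\<in>{1..d}. ordstat_cdf d k (x k))" for x
    by (intro restrict_ext marginal_df_order_df)
  show "is_copula d (ordstat_copula d) \<and>
     (\<forall>x\<in>space (ereal_space d). order_df d (product_copula d) x =
        ordstat_copula d (\<lambda>k\<in>{1..d}. marginal_df d (order_df d (product_copula d)) k (x k)))"
    unfolding eq using is_copula_ordstat_copula order_df_eq_ordstat_copula by blast
  fix D assume D: "is_copula d D \<and> (\<forall>x\<in>space (ereal_space d). order_df d (product_copula d) x =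
        D (\<lambda>k\<in>{1..d}. marginal_df d (order_df d (product_copula d)) k (x k)))"
  show "D = ordstat_copula d"
  proof (rule extensionalityI)
    show "D \<in> extensional (unit_cube d)" "ordstat_copula d \<in> extensional (unit_cube d)"
      using D is_copula_ordstat_copula by (auto simp: is_copula_def PiE_def)
    fix u assume "u \<in> unit_cube d"
    then obtain x where "x \<in> space (ereal_space d)" "u = (\<lambda>k\<in>{1..d}. ordstat_cdf d k (x k))"
      by (rule unit_cube_cdf_surj)
    then show "D u = ordstat_copula d u"
      using D unfolding eq by (metis order_df_eq_ordstat_copula)
  qed
qed

section \<open>Kendall's tau\<close>

lemma integral_clip_unif: "(\<integral>x. clip x \<partial>unif) = 1 / 2"
proof -
  have "(\<integral>\<^sup>+x. ennreal (clip x) \<partial>unif) = (\<integral>\<^sup>+x. ennreal x * indicator {0..1} x \<partial>lborel)"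
    by (subst nn_integral_unif) (auto intro!: nn_integral_cong simp: clip_def split: split_indicator)
  also have "\<dots> = ennreal (1 ^ 2 / 2 - 0 ^ 2 / 2)"
    by (intro nn_integral_FTC_Icc[where F="\<lambda>x. x ^ 2 / 2"]) (auto intro!: derivative_eq_intros)
  also have "1 ^ 2 / 2 - 0 ^ 2 / 2 = (1 / 2 :: real)" by simp
  finally have eq: "(\<integral>\<^sup>+x. ennreal (clip x) \<partial>unif) = ennreal (1 / 2)" .
  have "(\<integral>x. clip x \<partial>unif) = enn2real (\<integral>\<^sup>+x. ennreal (clip x) \<partial>unif)"
    using clip_bounds by (intro integral_eq_nn_integral) auto
  also have "\<dots> = 1 / 2"
    unfolding eq by (rule enn2real_ennreal) simp
  finally show ?thesis .
qed

lemma integrable_clip_unif: "integrable unif clip"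
  using clip_bounds by (intro unif.integrable_const_bound[of _ 1]) auto

lemma measurable_into_unit_cube:
  assumes "\<And>k. k \<in> {1..d} \<Longrightarrow> f k \<in> borel_measurable M" "\<And>k w. k \<in> {1..d} \<Longrightarrow> f k w \<in> {0..1::real}"
  shows "(\<lambda>w. \<lambda>k\<in>{1..d}. f k w) \<in> measurable M (PiM {1..d} (\<lambda>_. restrict_space borel {0..1}))"
  using assms by (intro measurable_restrict measurable_restrict_space2) auto

lemma sets_box_unit_cube:
  "u \<in> unit_cube d \<Longrightarrow> (\<Pi>\<^sub>E k\<in>{1..d}. {0..u k}) \<in> sets (PiM {1..d} (\<lambda>_. restrict_space borel {0..1}))"
  by (intro sets_PiM_I_finite) (auto simp: sets_restrict_space_iff unit_cube_def PiE_iff)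

lemma measurable_unit_cube_component:
  assumes "k \<in> {1..d}"
  shows "(\<lambda>u. u k) \<in> borel_measurable (PiM {1..d} (\<lambda>_. restrict_space borel {0..1::real}))"
proof -
  have "(\<lambda>x::real. x) \<in> borel_measurable (restrict_space borel {0..1})"
    by (rule measurable_restrict_space1) simp
  from measurable_compose[OF measurable_component_singleton[OF assms] this] show ?thesis .
qed

text \<open>\<open>clip\<close> moves the sample, which lives on the whole line, into the cube and
  leaves it almost surely unchanged.\<close>

lemma copula_measure_product_copula:
  "copula_measure d (product_copula d) =
    distr (iid d) (PiM {1..d} (\<lambda>_. restrict_space borel {0..1})) (\<lambda>w. \<lambda>k\<in>{1..d}. clip (w k))"
    (is "_ = distr _ ?N ?V")
proof (rule copula_measure_eqI)
  have V: "?V \<in> measurable (iid d) ?N"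
    using clip_bounds by (intro measurable_into_unit_cube) measurable
  then show "prob_space (distr (iid d) ?N ?V)"
    by (intro prob_space.prob_space_distr prob_space_PiM_unif)
  fix u assume u: "u \<in> unit_cube d"
  have "measure (distr (iid d) ?N ?V) (\<Pi>\<^sub>E k\<in>{1..d}. {0..u k}) =
    measure (iid d) (?V -` (\<Pi>\<^sub>E k\<in>{1..d}. {0..u k}) \<inter> space (iid d))"
    by (rule measure_distr[OF V sets_box_unit_cube[OF u]])
  also have "?V -` (\<Pi>\<^sub>E k\<in>{1..d}. {0..u k}) \<inter> space (iid d) = (\<Pi>\<^sub>E k\<in>{1..d}. {s. clip s \<le> u k})"
    using clip_bounds by (auto simp: space_PiM PiE_iff)
  also have "measure (iid d) \<dots> = (\<Prod>k=1..d. measure unif {s. clip s \<le> u k})"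
    by (rule measure_iid_box) measurable
  also have "\<dots> = (\<Prod>k=1..d. u k)"
  proof (rule prod.cong[OF refl])
    fix k assume "k \<in> {1..d}"
    then have k: "0 \<le> u k" "u k \<le> 1" using u by (auto simp: unit_cube_def)
    \<comment> \<open>For the bound \<open>1\<close> every \<open>s\<close> qualifies, since larger
      values are truncated to \<open>1\<close>.\<close>
    have "{s. clip s \<le> u k} = (if u k = 1 then UNIV else {..u k})"
      using k by (auto simp: clip_def)
    then show "measure unif {s. clip s \<le> u k} = u k"
      using k unif.prob_space by (auto simp: measure_unif_atMost clip_def)
  qed
  also have "\<dots> = product_copula d u"
    using u by (simp add: product_copula_def)
  finally show "measure (distr (iid d) ?N ?V) (\<Pi>\<^sub>E k\<in>{1..d}. {0..u k}) = product_copula d u" .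
qed simp

text \<open>By independence, the expectation of the product is the product of \<open>d\<close>
  expectations equal to \<open>1 / 2\<close>.\<close>

lemma copula_bracket_product_copula:
  "copula_bracket d (product_copula d) (product_copula d) = 1 / 2 ^ d"
proof -
  let ?N = "PiM {1..d} (\<lambda>_. restrict_space borel {0..1::real})"
  let ?V = "\<lambda>w::nat\<Rightarrow>real. \<lambda>k\<in>{1..d}. clip (w k)"
  have V: "?V \<in> measurable (iid d) ?N"
    using clip_bounds by (intro measurable_into_unit_cube) measurable
  have space: "space ?N = unit_cube d"
    by (auto simp: space_PiM unit_cube_def space_restrict_space)
  have "(\<lambda>u. \<Prod>k=1..d. u k) \<in> borel_measurable ?N"
    by (intro borel_measurable_prod measurable_unit_cube_component)
  then have M: "product_copula d \<in> borel_measurable ?N"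
    by (subst measurable_cong[of _ _ "\<lambda>u. \<Prod>k=1..d. u k"]) (simp_all add: space product_copula_def del: One_nat_def)
  have "copula_bracket d (product_copula d) (product_copula d) = (\<integral>w. product_copula d (?V w) \<partial>iid d)"
    unfolding copula_bracket_def copula_measure_product_copula by (rule integral_distr[OF V M])
  also have "\<dots> = (\<integral>w. (\<Prod>k=1..d. clip (w k)) \<partial>iid d)"
  proof -
    have "?V w \<in> unit_cube d" for w
      using clip_bounds by (auto simp: unit_cube_def)
    then show ?thesis by (simp add: product_copula_def)
  qed
  also have "\<dots> = (\<Prod>k=1..d. \<integral>x. clip x \<partial>unif)"
    using integrable_clip_unif by (intro unif_prod.product_integral_prod) auto
  also have "\<dots> = 1 / 2 ^ d"
    by (simp add: integral_clip_unif power_one_over)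
  finally show ?thesis .
qed

section \<open>The measure of the order transform\<close>

lemma measurable_ordstat_ranks_unit_cube:
  "ordstat_ranks d \<in> measurable (iid d) (PiM {1..d} (\<lambda>_. restrict_space borel {0..1}))"
proof -
  have "(\<lambda>w. \<lambda>k\<in>{1..d}. ordstat_ranks d w k)
      \<in> measurable (iid d) (PiM {1..d} (\<lambda>_. restrict_space borel {0..1}))"
    using ordstat_ranks_in_unit_cube[of d]
    by (intro measurable_into_unit_cube measurable_ordstat_ranks) (auto simp: unit_cube_def PiE_iff)
  moreover have "(\<lambda>k\<in>{1..d}. ordstat_ranks d w k) = ordstat_ranks d w" for w
    by (simp add: ordstat_ranks_def fun_eq_iff)
  ultimately show ?thesis by simp
qed

text \<open>The copula is a parameter integral of a jointly measurable function, and so measurable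
  in the parameter.\<close>

lemma measurable_ordstat_copula:
  "ordstat_copula d \<in> borel_measurable (PiM {1..d} (\<lambda>_. restrict_space borel {0..1}))"
    (is "_ \<in> borel_measurable ?N")
proof -
  have [measurable]: "(\<lambda>w. ordstat_ranks d w k) \<in> borel_measurable (iid d)"
    and [measurable]: "(\<lambda>u. u k) \<in> borel_measurable ?N" if "k \<in> {1..d}" for k
    using measurable_ordstat_ranks[OF that] measurable_unit_cube_component[OF that] by auto
  have "(\<lambda>u. \<integral>w. (\<Prod>k=1..d. if ordstat_ranks d w k \<le> u k then 1 else 0 :: real) \<partial>iid d) \<in> borel_measurable ?N"
  proof (rule sigma_finite_measure.borel_measurable_lebesgue_integral
      [OF prob_space_imp_sigma_finite[OF prob_space_PiM_unif]])
    show "(\<lambda>(u, w). \<Prod>k=1..d. if ordstat_ranks d w k \<le> u k then 1 else 0 :: real)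
        \<in> borel_measurable (?N \<Otimes>\<^sub>M iid d)"
      by measurable
  qed
  moreover have "space ?N = unit_cube d"
    by (auto simp: space_PiM unit_cube_def space_restrict_space)
  ultimately show ?thesis
    by (subst measurable_cong[where g="\<lambda>u. \<integral>w. (\<Prod>k=1..d. if ordstat_ranks d w k \<le> u k then 1 else 0) \<partial>iid d"])
      (auto simp: ordstat_copula_eq_integral indicator_def of_bool_def)
qed

lemma copula_measure_ordstat_copula:
  "copula_measure d (ordstat_copula d) =
    distr (iid d) (PiM {1..d} (\<lambda>_. restrict_space borel {0..1})) (ordstat_ranks d)"
    (is "_ = distr _ ?N _")
proof (rule copula_measure_eqI)
  have V: "ordstat_ranks d \<in> measurable (iid d) ?N"
    by (rule measurable_ordstat_ranks_unit_cube)
  then show "prob_space (distr (iid d) ?N (ordstat_ranks d))"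
    by (intro prob_space.prob_space_distr prob_space_PiM_unif)
  fix u assume u: "u \<in> unit_cube d"
  have "measure (distr (iid d) ?N (ordstat_ranks d)) (\<Pi>\<^sub>E k\<in>{1..d}. {0..u k}) =
    measure (iid d) (ordstat_ranks d -` (\<Pi>\<^sub>E k\<in>{1..d}. {0..u k}) \<inter> space (iid d))"
    by (rule measure_distr[OF V sets_box_unit_cube[OF u]])
  also have "ordstat_ranks d -` (\<Pi>\<^sub>E k\<in>{1..d}. {0..u k}) \<inter> space (iid d) =
      {w\<in>space (iid d). \<forall>k\<in>{1..d}. ordstat_ranks d w k \<le> u k}"
    using ordstat_ranks_in_unit_cube[of d] by (auto simp: PiE_iff unit_cube_def)
  finally show "measure (distr (iid d) ?N (ordstat_ranks d)) (\<Pi>\<^sub>E k\<in>{1..d}. {0..u k}) = ordstat_copula d u"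
    using u by (simp add: ordstat_copula_def)
qed simp

section \<open>From order statistics to the ballot event\<close>

lemma ballot_iff_all:
  assumes "finite A" "finite B"
  shows "ballot A B x \<longleftrightarrow> (\<forall>s. card {i\<in>B. x i \<le> s} \<le> card {i\<in>A. x i \<le> s})"
proof
  assume b: "ballot A B x"
  show "\<forall>s. card {i\<in>B. x i \<le> s} \<le> card {i\<in>A. x i \<le> s}"
  proof
    fix s
    show "card {i\<in>B. x i \<le> s} \<le> card {i\<in>A. x i \<le> s}"
    proof (cases "{i\<in>B. x i \<le> s} = {}")
      case True
      then show ?thesis by (simp only: card.empty)
    next
      case False
      \<comment> \<open>From the largest counted point \<open>x j\<close> of \<open>B\<close> up to
        \<open>s\<close>, the count of \<open>B\<close> stays the same while that of
        \<open>A\<close> can only grow.\<close>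
      then obtain j where j: "j \<in> B" "x j \<le> s" "\<forall>i\<in>{i\<in>B. x i \<le> s}. x i \<le> x j"
        using finite_has_max_value[of "{i\<in>B. x i \<le> s}" x] assms by auto
      then have "{i\<in>B. x i \<le> s} = {i\<in>B. x i \<le> x j}" by force
      also have "card \<dots> \<le> card {i\<in>A. x i \<le> x j}"
        using b j by (auto simp: ballot_def)
      also have "\<dots> \<le> card {i\<in>A. x i \<le> s}"
        using j assms by (intro card_mono) auto
      finally show ?thesis .
    qed
  qed
qed (auto simp: ballot_def)

text \<open>The second sample is stored at the indices shifted by \<open>d\<close>. Both sides
  compare counts: one direction takes the level to be its \<open>k\<close>-th order statistic, the
  other takes \<open>k\<close> to be its count at the given level.\<close>

lemma ballot_iff_ordstat_le:
  "ballot {1..d} {d+1..2*d} x \<longleftrightarrow>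
    (\<forall>k\<in>{1..d}. ordstat d x k \<le> ordstat d (\<lambda>i. x (i + d)) k)"
proof -
  have "card {i\<in>{d+1..2*d}. x i \<le> s} = card {i\<in>{1..d}. x (i + d) \<le> s}" for s
    by (rule bij_betw_same_card[symmetric, of "\<lambda>i. i + d"])
      (rule bij_betw_byWitness[of _ "\<lambda>i. i - d"], auto)
  then have "ballot {1..d} {d+1..2*d} x \<longleftrightarrow>
      (\<forall>s. card {i\<in>{1..d}. x (i + d) \<le> s} \<le> card {i\<in>{1..d}. x i \<le> s})"
    by (subst ballot_iff_all) auto
  also have "\<dots> \<longleftrightarrow> (\<forall>k\<in>{1..d}. ordstat d x k \<le> ordstat d (\<lambda>i. x (i + d)) k)"
  proof (intro iffI allI ballI)
    fix k assume *: "\<forall>s. card {i\<in>{1..d}. x (i + d) \<le> s} \<le> card {i\<in>{1..d}. x i \<le> s}"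
      and k: "k \<in> {1..d}"
    let ?s = "ordstat d (\<lambda>i. x (i + d)) k"
    have "k \<le> card {i\<in>{1..d}. x (i + d) \<le> ?s}"
      using ordstat_le_iff[OF k, of "\<lambda>i. x (i + d)" ?s] by simp
    also have "\<dots> \<le> card {i\<in>{1..d}. x i \<le> ?s}" using * by blast
    finally show "ordstat d x k \<le> ?s"
      using ordstat_le_iff[OF k, of x ?s] by blast
  next
    fix s assume *: "\<forall>k\<in>{1..d}. ordstat d x k \<le> ordstat d (\<lambda>i. x (i + d)) k"
    let ?k = "card {i\<in>{1..d}. x (i + d) \<le> s}"
    show "?k \<le> card {i\<in>{1..d}. x i \<le> s}"
    proof (cases "?k = 0")
      case False
      have "?k \<le> card {1..d}" by (intro card_mono) auto
      then have "?k \<le> d" unfolding card_atLeastAtMost by linarith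
      with False have k: "?k \<in> {1..d}" unfolding atLeastAtMost_iff by linarith
      then have "ordstat d (\<lambda>i. x (i + d)) ?k \<le> s"
        by (subst ordstat_le_iff) auto
      with * k have "ordstat d x ?k \<le> s" by (blast intro: order_trans)
      then show ?thesis using ordstat_le_iff[OF k, of x s] by blast
    qed linarith
  qed
  finally show ?thesis .
qed

text \<open>For \<open>t = 1\<close> the bound on the points holds almost surely, and two kinds of
  \<open>d\<close> points each give the ballot value \<open>1 / (d + 1)\<close>.\<close>

lemma emeasure_ballot_1:
  "emeasure (PiM ({1..d} \<union> {d+1..2*d}) (\<lambda>_. unif))
    {x\<in>space (PiM ({1..d} \<union> {d+1..2*d}) (\<lambda>_. unif)). ballot {1..d} {d+1..2*d} x} = ennreal (1 / (real d + 1))"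
proof -
  let ?P = "PiM ({1..d} \<union> {d+1..2*d}) (\<lambda>_. unif)"
  have [measurable]: "Measurable.pred ?P (ballot {1..d} {d+1..2*d})"
    by (rule measurable_ballot) auto
  have "AE x in ?P. \<forall>i\<in>{1..d} \<union> {d+1..2*d}. x i \<in> {0<..<1}"
    by (intro AE_finite_allI AE_PiM_component[of _ "\<lambda>_. unif"] prob_space_unif AE_unif_Ioo) auto
  then have "emeasure ?P {x\<in>space ?P. ballot {1..d} {d+1..2*d} x} =
    emeasure ?P {x\<in>space ?P. (\<forall>i\<in>{1..d} \<union> {d+1..2*d}. x i < 1) \<and> ballot {1..d} {d+1..2*d} x}"
    by (intro emeasure_eq_AE) (auto elim!: eventually_mono)
  also have "\<dots> = ennreal (1 / (real d + 1))"
    by (subst emeasure_ballot) auto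
  finally show ?thesis .
qed

text \<open>The outer sample is moved to the indices \<open>{d+1..2*d}\<close>, so that
  \<open>merge\<close> joins the two independent samples into one family of \<open>2 * d\<close>
  uniform variables, to which the ballot result applies.\<close>

lemma nn_integral_ordstat_le:
  "(\<integral>\<^sup>+w. emeasure (iid d) {u\<in>space (iid d). \<forall>k\<in>{1..d}. ordstat d u k \<le> ordstat d w k} \<partial>iid d)
    = ennreal (1 / (real d + 1))"
proof -
  let ?A = "{1..d}" and ?B = "{d+1..2*d}"
  let ?PB = "PiM {d+1..2*d} (\<lambda>_. unif)" and ?P = "PiM ({d+1..2*d} \<union> {1..d}) (\<lambda>_. unif)"
  let ?r = "\<lambda>y::nat\<Rightarrow>real. \<lambda>i\<in>{1..d}. y (i + d)"
  let ?g = "\<lambda>w. emeasure (iid d) {u\<in>space (iid d). \<forall>k\<in>{1..d}. ordstat d u k \<le> ordstat d w k}"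
  have reindex: "distr ?PB (iid d) ?r = iid d"
    using distr_PiM_reindex[of ?B "\<lambda>_. unif" "\<lambda>i. i + d" ?A] prob_space_unif by (auto simp: inj_on_def)
  have r: "?r \<in> measurable ?PB (iid d)"
    by (intro measurable_restrict) (auto intro!: measurable_component_singleton)
  have g: "?g \<in> borel_measurable (iid d)"
  proof -
    have "{p \<in> space (iid d \<Otimes>\<^sub>M iid d). \<forall>k\<in>{1..d}. ordstat d (snd p) k \<le> ordstat d (fst p) k}
       \<in> sets (iid d \<Otimes>\<^sub>M iid d)"
    proof -
      have [measurable]: "(\<lambda>w. ordstat d w k) \<in> borel_measurable (iid d)" if "k \<in> {1..d}" for k
        using that by (rule measurable_ordstat_iid)
      show ?thesis by measurable
    qed
    from sigma_finite_measure.measurable_emeasure_Pair[OF _ this]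
    have "(\<lambda>w. emeasure (iid d) (Pair w -` {p \<in> space (iid d \<Otimes>\<^sub>M iid d). \<forall>k\<in>{1..d}. ordstat d (snd p) k \<le> ordstat d (fst p) k}))
      \<in> borel_measurable (iid d)"
      using prob_space_imp_sigma_finite[OF prob_space_PiM_unif] by blast
    then show ?thesis
      by (rule measurable_cong[THEN iffD1, rotated])
        (auto simp: space_pair_measure intro!: arg_cong2[where f=emeasure])
  qed
  have "(\<integral>\<^sup>+w. ?g w \<partial>iid d) = (\<integral>\<^sup>+y. ?g (?r y) \<partial>?PB)"
    by (subst reindex[symmetric]) (rule nn_integral_distr[OF r], use g in simp)
  also have "\<dots> = (\<integral>\<^sup>+y. (\<integral>\<^sup>+x. indicator {x. ballot ?A ?B x} (merge ?B ?A (y, x)) \<partial>iid d) \<partial>?PB)"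
  proof (rule nn_integral_cong)
    fix y assume "y \<in> space ?PB"
    have "{u\<in>space (iid d). \<forall>k\<in>{1..d}. ordstat d u k \<le> ordstat d (?r y) k} \<in> sets (iid d)"
      by measurable
    then have "?g (?r y) = (\<integral>\<^sup>+x. indicator {u. \<forall>k\<in>{1..d}. ordstat d u k \<le> ordstat d (?r y) k} x \<partial>iid d)"
      by (rule emeasure_Collect_eq_nn_integral)
    also have "\<dots> = (\<integral>\<^sup>+x. indicator {x. ballot ?A ?B x} (merge ?B ?A (y, x)) \<partial>iid d)"
    proof (rule nn_integral_cong)
      fix x assume "x \<in> space (iid d)"
      have "ordstat d (merge ?B ?A (y, x)) k = ordstat d x k" for k
        by (rule ordstat_cong) (auto simp: merge_def)
      moreover have "ordstat d (\<lambda>i. merge ?B ?A (y, x) (i + d)) k = ordstat d (?r y) k" for k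
        by (rule ordstat_cong) (auto simp: merge_def)
      ultimately have "ballot ?A ?B (merge ?B ?A (y, x)) \<longleftrightarrow>
          (\<forall>k\<in>{1..d}. ordstat d x k \<le> ordstat d (?r y) k)"
        by (simp only: ballot_iff_ordstat_le)
      then show "indicator {u. \<forall>k\<in>{1..d}. ordstat d u k \<le> ordstat d (?r y) k} x =
          (indicator {x. ballot ?A ?B x} (merge ?B ?A (y, x)) :: ennreal)"
        by (simp only: indicator_def mem_Collect_eq)
    qed
    finally show "?g (?r y) = (\<integral>\<^sup>+x. indicator {x. ballot ?A ?B x} (merge ?B ?A (y, x)) \<partial>iid d)" .
  qed
  also have "\<dots> = (\<integral>\<^sup>+x. indicator {x. ballot ?A ?B x} x \<partial>?P)"
  proof (rule unif_prod.product_nn_integral_fold[symmetric])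
    have "Measurable.pred ?P (ballot ?A ?B)"
      by (rule measurable_ballot) auto
    then show "indicator {x. ballot ?A ?B x} \<in> borel_measurable ?P"
      by (intro borel_measurable_indicator') simp
  qed auto
  also have "\<dots> = emeasure ?P {x\<in>space ?P. ballot ?A ?B x}"
  proof (rule emeasure_Collect_eq_nn_integral[symmetric])
    have [measurable]: "Measurable.pred ?P (ballot ?A ?B)"
      by (rule measurable_ballot) auto
    show "{x\<in>space ?P. ballot ?A ?B x} \<in> sets ?P" by measurable
  qed
  also have "\<dots> = ennreal (1 / (real d + 1))"
    unfolding Un_commute[of ?B ?A] by (rule emeasure_ballot_1)
  finally show ?thesis .
qed

text \<open>Evaluated at the ranks of \<open>w\<close>, the copula is \<open>order_df\<close> at the
  order statistics of \<open>w\<close>, for every \<open>w\<close>. Integration then gives the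
  comparison probability of two independent samples.\<close>

lemma copula_bracket_ordstat_copula:
  "copula_bracket d (ordstat_copula d) (ordstat_copula d) = 1 / (real d + 1)"
proof -
  let ?N = "PiM {1..d} (\<lambda>_. restrict_space borel {0..1::real})"
  have "copula_bracket d (ordstat_copula d) (ordstat_copula d) = (\<integral>w. ordstat_copula d (ordstat_ranks d w) \<partial>iid d)"
    unfolding copula_bracket_def copula_measure_ordstat_copula
    by (rule integral_distr[OF measurable_ordstat_ranks_unit_cube measurable_ordstat_copula])
  also have "\<dots> = (\<integral>w. measure (iid d) {u\<in>space (iid d). \<forall>k\<in>{1..d}. ordstat d u k \<le> ordstat d w k} \<partial>iid d)"
  proof (rule Bochner_Integration.integral_cong[OF refl])
    fix w
    have "ordstat_copula d (ordstat_ranks d w) = order_df d (product_copula d) (\<lambda>k. ereal (ordstat d w k))"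
      by (simp only: order_df_eq_ordstat_copula ordstat_ranks_def)
    then show "ordstat_copula d (ordstat_ranks d w) =
        measure (iid d) {u\<in>space (iid d). \<forall>k\<in>{1..d}. ordstat d u k \<le> ordstat d w k}"
      by (simp add: order_df_product_copula)
  qed
  also have "\<dots> = enn2real (\<integral>\<^sup>+w. emeasure (iid d) {u\<in>space (iid d). \<forall>k\<in>{1..d}. ordstat d u k \<le> ordstat d w k} \<partial>iid d)"
  proof (subst integral_eq_nn_integral)
    have "(\<lambda>w. ordstat_copula d (ordstat_ranks d w)) \<in> borel_measurable (iid d)"
      using measurable_compose[OF measurable_ordstat_ranks_unit_cube measurable_ordstat_copula] .
    then show "(\<lambda>w. measure (iid d) {u\<in>space (iid d). \<forall>k\<in>{1..d}. ordstat d u k \<le> ordstat d w k}) \<in> borel_measurable (iid d)"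
      unfolding ordstat_ranks_def[abs_def] order_df_eq_ordstat_copula[symmetric] order_df_product_copula by simp
  qed (auto simp: unif_prod.emeasure_eq_measure)
  also have "\<dots> = 1 / (real d + 1)"
    unfolding nn_integral_ordstat_le by (rule enn2real_ennreal) simp
  finally show ?thesis .
qed


text \<open>For \<open>d \<ge> 2\<close> the denominator \<open>2 ^ (d - 1) - 1\<close> is
  positive.\<close>

lemma kendall_tau_order_transform:
  fixes d :: nat
  assumes "d \<ge> 2"
  shows "kendall_tau d (order_transform d (product_copula d)) =
      (2 ^ d - (real d + 1)) / ((2 ^ (d - 1) - 1) * (real d + 1))"
proof -
  have "(1::real) < 2 ^ (d - 1)"
    using assms by (intro one_less_power) auto
  then show ?thesis
    unfolding kendall_tau_def order_transform_product_copula copula_bracket_ordstat_copula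
    by (simp add: field_simps)
qed

lemma Suc_less_two_power: "d \<ge> 2 \<Longrightarrow> d + 1 < 2 ^ d"
proof (induction d rule: nat_induct_at_least)
  case (Suc d)
  then show ?case by simp
qed simp

theorem theorem6p2:
  "(\<forall>d::nat. d \<ge> 2 \<longrightarrow>
      (copula_bracket d (product_copula d) (product_copula d) = 1 / 2 ^ d \<and>
       1 / 2 ^ d < 1 / (real d + 1) \<and>
       1 / (real d + 1) =
         copula_bracket d (order_transform d (product_copula d)) (order_transform d (product_copula d))) \<and>
      (kendall_tau d (product_copula d) = 0 \<and>
       0 < (2 ^ d - (real d + 1)) / ((2 ^ (d - 1) - 1) * (real d + 1)) \<and>
       (2 ^ d - (real d + 1)) / ((2 ^ (d - 1) - 1) * (real d + 1)) =
         kendall_tau d (order_transform d (product_copula d)))) \<and>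
   (\<lambda>d. kendall_tau d (order_transform d (product_copula d))) \<longlonglongrightarrow> 0"
proof (intro conjI allI impI)
  fix d :: nat assume d: "d \<ge> 2"
  have "real (d + 1) < real (2 ^ d)"
    using Suc_less_two_power[OF d] by (rule of_nat_less_iff[THEN iffD2])
  then have less: "real d + 1 < 2 ^ d" by simp
  show "copula_bracket d (product_copula d) (product_copula d) = 1 / 2 ^ d"
    by (rule copula_bracket_product_copula)
  show "1 / 2 ^ d < 1 / (real d + 1)"
    using less by (simp add: field_simps)
  show "1 / (real d + 1) =
      copula_bracket d (order_transform d (product_copula d)) (order_transform d (product_copula d))"
    by (simp add: order_transform_product_copula copula_bracket_ordstat_copula)
  show "kendall_tau d (product_copula d) = 0"
    by (simp add: kendall_tau_def copula_bracket_product_copula)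
  have "(1::real) < 2 ^ (d - 1)"
    using d by (intro one_less_power) auto
  then show "0 < (2 ^ d - (real d + 1)) / ((2 ^ (d - 1) - 1) * (real d + 1))"
    using less by (intro divide_pos_pos mult_pos_pos) auto
  show "(2 ^ d - (real d + 1)) / ((2 ^ (d - 1) - 1) * (real d + 1)) =
      kendall_tau d (order_transform d (product_copula d))"
    using kendall_tau_order_transform[OF d] by simp
next
  \<comment> \<open>The closed form behaves like \<open>2 / (d + 1)\<close>; it agrees with
    Kendall's tau from \<open>d = 2\<close> on, which is enough for the limit.\<close>
  have "(\<lambda>d::nat. (2 ^ d - (real d + 1)) / ((2 ^ (d - 1) - 1) * (real d + 1))) \<longlonglongrightarrow> 0"
    by real_asymp
  then show "(\<lambda>d. kendall_tau d (order_transform d (product_copula d))) \<longlonglongrightarrow> 0"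
    by (rule Lim_transform_eventually)
      (auto simp: eventually_sequentially kendall_tau_order_transform intro!: exI[of _ 2])
qed

end
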